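(* In the setting described in the context, let $f\mapsto\sup_{y\in K}f(y)$ be measurable on $\mathbb{H}$, and let $T$ be a max-linear functional with $T(\mathbf{1})=1$. Then the optimization problem $$Q^*=\arg\min_{g}Q^*_g,\qquad Q^*_g=\mathbb{E}\min\Big\{m\in\mathbb{N}:\ \operatorname*{ess\,sup}_{f\in\mathbb{H}}\frac{\sup_{y\in K}f(y)}{g(f)\,T(Z^{(m)})}\le\sum_{j=1}^{m+1}E_j\Big\},$$ over all admissible densities $g$, is solvable if and only if $$c=\int_{\mathbb{H}}\sup_{y\in K}f(y)\,H(\mathrm{d}f)<\infty .$$ In this case, $$g^*\in Q^*=\arg\min_g Q^{(1)}_g=\arg\min_g Q^{(2)}_g(y_0)\qquad\text{for every }y_0\in K,$$ where $g^*(f)=c^{-1}\sup_{y\in K}f(y)$, $f\in\mathbb{H}$ (the density that yields the normalized spectral representation, in which all spectral functions $f/g^*(f)$ have supremum $c$ over $K$); that is, the normalized spectral representation is optimal for this optimization problem. The solution is unique $H$-almost surely, i.e. every $g\in Q^*$ satisfies $g=g^*$ $H$-almost everywhere.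
   Context: Setting. $K$ is a compact Polish space, $\mathbb{H}\subset[0,\infty)^K$ is a Polish space of functions with measurable evaluation maps, and $H$ is a locally finite measure on $\mathbb{H}$ with $\int_{\mathbb{H}}f(y)\,H(\mathrm{d}f)=1$ for all $y\in K$. $Z(y)=\max_{(t,f)\in\Pi}tf(y)$, $y\in K$, with $\Pi$ a Poisson point process on $(0,\infty)\times\mathbb{H}$ with intensity $t^{-2}\,\mathrm{d}t\,H(\mathrm{d}f)$; it is assumed that $\mathbb{P}(\inf_{y\in K}Z(y)>0)=1$. Admissible density: a measurable $g\ge0$ on $\mathbb{H}$ with $\int g\,\mathrm{d}H=1$ and $H(\{f:g(f)=0,\ \sup_{y\in K}f(y)>0\})=0$. Write $gH(A)=\int_A g\,\mathrm{d}H$. All $\arg\min_g$ are over admissible densities, and $\operatorname*{ess\,sup}_{f\in\mathbb{H}}$ is with respect to the probability measure $gH$. For an admissible $g$, let $E_1,E_2,\dots$ be standard exponential and $f_1,f_2,\dots$ have law $gH$, all independent, and $$Z^{(m)}(y)=\max_{1\le i\le m}\frac{1}{\sum_{j=1}^iE_j}\cdot\frac{f_i(y)}{g(f_i)},\qquad y\in K.$$ A functional $T:[0,\infty)^K\to[0,\infty)$ is max-linear if $T(\max\{a_1h_1,a_2h_2\})=\max\{a_1T(h_1),a_2T(h_2)\}$ for all $a_1,a_2>0$ and $h_1,h_2:K\to[0,\infty)$; $\mathbf{1}$ is the constant function $1$; $f\mapsto T(f)$ is taken measurable on $\mathbb{H}$. $$Q^{(1)}_g=\mathbb{E}\min\Big\{m\in\mathbb{N}:\operatorname*{ess\,sup}_{f\in\mathbb{H}}\frac{\sup_{y\in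 K}f(y)}{g(f)\sup_{\tilde y\in K}Z^{(m)}(\tilde y)}\le\sum_{j=1}^{m+1}E_j\Big\},$$ $$Q^{(2)}_g(y_0)=\mathbb{E}\min\Big\{m\in\mathbb{N}:\operatorname*{ess\,sup}_{f\in\mathbb{H}}\frac{\sup_{y\in K}f(y)}{g(f)Z^{(m)}(y_0)}\le\sum_{j=1}^{m+1}E_j\Big\}.$$ Conventions: $\min\emptyset=\infty$; a positive number divided by $0$ is $+\infty$. An optimization problem $\arg\min_{x\in A}h(x)$ with $h:A\to\mathbb{R}\cup\{\infty\}$ is called solvable if $\inf_{x\in A}h(x)\in(-\infty,\infty)$ and there is $x_0\in A$ with $h(x_0)=\inf_{x\in A}h(x)$. *)

theory Defs
  imports "HOL-Probability.Probability"
begin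

section \<open>Spaces of spectral functions\<close>

definition polish_topology :: "'a topology \<Rightarrow> bool" where
  "polish_topology X \<longleftrightarrow> completely_metrizable_space X \<and> second_countable X"

definition borel_measure_on :: "'a topology \<Rightarrow> 'a measure \<Rightarrow> bool" where
  "borel_measure_on X H \<longleftrightarrow> space H = topspace X \<and> sets H = sigma_sets (topspace X) {U. openin X U}"

definition locally_finite_on :: "'a topology \<Rightarrow> 'a measure \<Rightarrow> bool" where
  "locally_finite_on X H \<longleftrightarrow> (\<forall>x\<in>topspace X. \<exists>U. openin X U \<and> x \<in> U \<and> emeasure H U < \<infinity>)"

text \<open>The supremum is taken in \<open>[0,\<infinity>]\<close>, since a spectral function need not be bounded.\<close>

definition sup_fun :: "('k \<Rightarrow> real) \<Rightarrow> ennreal" where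
  "sup_fun h = (SUP y. ennreal (h y))"

section \<open>Poisson point processes\<close>

definition num_points :: "'a set \<Rightarrow> 'a set \<Rightarrow> ennreal" where
  "num_points N A = emeasure (count_space UNIV) (N \<inter> A)"

text \<open>
  The process is modelled as a random set of points. This loses nothing for an intensity
  such as \<open>spectral_intensity\<close> below, whose first coordinate is diffuse, because such a
  process has no multiple points almost surely.
\<close>

definition poisson_point_process :: "'w measure \<Rightarrow> 'a measure \<Rightarrow> ('w \<Rightarrow> 'a set) \<Rightarrow> bool" where
  "poisson_point_process \<Omega> \<mu> N \<longleftrightarrow>
     prob_space \<Omega> \<and>
     (\<forall>\<omega>\<in>space \<Omega>. N \<omega> \<subseteq> space \<mu>) \<and>
     (\<forall>A\<in>sets \<mu>. (\<lambda>\<omega>. num_points (N \<omega>) A) \<in> borel_measurable \<Omega>) \<and>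
     (\<forall>A\<in>sets \<mu>. emeasure \<mu> A < \<infinity> \<longrightarrow>
        (\<forall>k::nat. measure \<Omega> {\<omega>\<in>space \<Omega>. num_points (N \<omega>) A = of_nat k}
                 = exp (- measure \<mu> A) * measure \<mu> A ^ k / fact k)) \<and>
     (\<forall>A\<in>sets \<mu>. emeasure \<mu> A = \<infinity> \<longrightarrow> (AE \<omega> in \<Omega>. num_points (N \<omega>) A = \<infinity>)) \<and>
     (\<forall>(I::nat set) A. finite I \<longrightarrow> disjoint_family_on A I \<longrightarrow> (\<forall>i\<in>I. A i \<in> sets \<mu>) \<longrightarrow>
        prob_space.indep_vars \<Omega> (\<lambda>_. borel) (\<lambda>i \<omega>. num_points (N \<omega>) (A i)) I)"

definition spectral_intensity :: "('k \<Rightarrow> real) measure \<Rightarrow> (real \<times> ('k \<Rightarrow> real)) measure" where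
  "spectral_intensity H =
     density (restrict_space lborel {0<..}) (\<lambda>t. ennreal (1 / t\<^sup>2)) \<Otimes>\<^sub>M H"

definition max_stable_process :: "(real \<times> ('k \<Rightarrow> real)) set \<Rightarrow> 'k \<Rightarrow> ennreal" where
  "max_stable_process N y = (SUP (t, f)\<in>N. ennreal (t * f y))"

section \<open>Admissible densities and max-linear functionals\<close>

text \<open>
  Densities take values in \<open>[0,\<infinity>]\<close>, as usual for \<^const>\<open>density\<close>. Integrability makes
  them finite almost everywhere; the value \<open>\<infinity>\<close> is only needed so that the normalized density
  can be written down for unbounded spectral functions.
\<close>

definition admissible :: "('k \<Rightarrow> real) measure \<Rightarrow> (('k \<Rightarrow> real) \<Rightarrow> ennreal) \<Rightarrow> bool" where
  "admissible H g \<longleftrightarrow>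
     g \<in> borel_measurable H \<and>
     (\<integral>\<^sup>+ f. g f \<partial>H) = 1 \<and>
     {f\<in>space H. g f = 0 \<and> 0 < sup_fun f} \<in> null_sets H"

definition sup_mass :: "('k \<Rightarrow> real) measure \<Rightarrow> ennreal" where
  "sup_mass H = (\<integral>\<^sup>+ f. sup_fun f \<partial>H)"

definition normalized_density :: "('k \<Rightarrow> real) measure \<Rightarrow> ('k \<Rightarrow> real) \<Rightarrow> ennreal" where
  "normalized_density H f = sup_fun f / sup_mass H"

text \<open>Only the values of \<open>T\<close> on nonnegative functions matter.\<close>

definition max_linear :: "(('k \<Rightarrow> real) \<Rightarrow> real) \<Rightarrow> bool" where
  "max_linear T \<longleftrightarrow>
     (\<forall>h. (\<forall>y. 0 \<le> h y) \<longrightarrow> 0 \<le> T h) \<and>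
     (\<forall>a1 a2 h1 h2. 0 < a1 \<longrightarrow> 0 < a2 \<longrightarrow> (\<forall>y. 0 \<le> h1 y) \<longrightarrow> (\<forall>y. 0 \<le> h2 y) \<longrightarrow>
        T (\<lambda>y. max (a1 * h1 y) (a2 * h2 y)) = max (a1 * T h1) (a2 * T h2))"

section \<open>The simulation algorithm\<close>

text \<open>
  Sequences are indexed from 0: \<open>E j\<close> and \<open>F i\<close> stand for the variables usually written
  \<open>E\<^sub>j\<^sub>+\<^sub>1\<close> and \<open>f\<^sub>i\<^sub>+\<^sub>1\<close>. The index set \<open>nat + nat\<close> merges both sequences, whose values have
  different types, into one mutually independent family.
\<close>

definition simulation_input ::
  "('k \<Rightarrow> real) measure \<Rightarrow> (('k \<Rightarrow> real) \<Rightarrow> ennreal) \<Rightarrow> 'w measure \<Rightarrow>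
   (nat \<Rightarrow> 'w \<Rightarrow> real) \<Rightarrow> (nat \<Rightarrow> 'w \<Rightarrow> 'k \<Rightarrow> real) \<Rightarrow> bool" where
  "simulation_input H g P E F \<longleftrightarrow>
     prob_space P \<and>
     (\<forall>j. distributed P lborel (E j) (exponential_density 1)) \<and>
     (\<forall>i. distributed P H (F i) g) \<and>
     prob_space.indep_sets P
       (case_sum (\<lambda>j. {E j -` A \<inter> space P | A. A \<in> sets borel})
                 (\<lambda>i. {F i -` A \<inter> space P | A. A \<in> sets H})) UNIV"

text \<open>
  For \<open>m \<ge> 1\<close>. Almost surely \<open>0 < g (F i) < \<infinity>\<close> for all \<open>i\<close>, so the quotient below is an
  ordinary one.
\<close>

definition partial_max ::
  "(('k \<Rightarrow> real) \<Rightarrow> ennreal) \<Rightarrow> (nat \<Rightarrow> 'w \<Rightarrow> real) \<Rightarrow> (nat \<Rightarrow> 'w \<Rightarrow> 'k \<Rightarrow> real) \<Rightarrow>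
   nat \<Rightarrow> 'w \<Rightarrow> 'k \<Rightarrow> real" where
  "partial_max g E F m \<omega> y =
     (MAX i\<in>{..<m}. 1 / (\<Sum>j\<le>i. E j \<omega>) * (F i \<omega> y / enn2real (g (F i \<omega>))))"

text \<open>
  The infimum is the minimum of a set of positive integers, and is \<open>\<infinity>\<close> for the empty set. The
  functional \<open>R\<close> is applied to the partial maximum in the stopping rule.
\<close>

definition stopping_number ::
  "('k \<Rightarrow> real) measure \<Rightarrow> (('k \<Rightarrow> real) \<Rightarrow> ennreal) \<Rightarrow> (('k \<Rightarrow> real) \<Rightarrow> ennreal) \<Rightarrow>
   (nat \<Rightarrow> 'w \<Rightarrow> real) \<Rightarrow> (nat \<Rightarrow> 'w \<Rightarrow> 'k \<Rightarrow> real) \<Rightarrow> 'w \<Rightarrow> ennreal" where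
  "stopping_number H R g E F \<omega> =
     (INF m\<in>{m::nat. 1 \<le> m \<and>
          esssup (density H g) (\<lambda>f. sup_fun f / (g f * R (partial_max g E F m \<omega>)))
            \<le> ennreal (\<Sum>j\<le>m. E j \<omega>)}. of_nat m)"

definition expected_number ::
  "('k \<Rightarrow> real) measure \<Rightarrow> (('k \<Rightarrow> real) \<Rightarrow> ennreal) \<Rightarrow> (('k \<Rightarrow> real) \<Rightarrow> ennreal) \<Rightarrow>
   'w measure \<Rightarrow> (nat \<Rightarrow> 'w \<Rightarrow> real) \<Rightarrow> (nat \<Rightarrow> 'w \<Rightarrow> 'k \<Rightarrow> real) \<Rightarrow> ennreal" where
  "expected_number H R g P E F = (\<integral>\<^sup>+ \<omega>. stopping_number H R g E F \<omega> \<partial>P)"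

section \<open>Optimization problems\<close>

definition solvable :: "('a \<Rightarrow> ennreal) \<Rightarrow> ('a \<Rightarrow> bool) \<Rightarrow> bool" where
  "solvable h A \<longleftrightarrow> (INF x\<in>Collect A. h x) < \<infinity> \<and> (\<exists>x0. A x0 \<and> h x0 = (INF x\<in>Collect A. h x))"

definition arg_min_set :: "('a \<Rightarrow> ennreal) \<Rightarrow> ('a \<Rightarrow> bool) \<Rightarrow> 'a set" where
  "arg_min_set h A = {x. is_arg_min h A x}"

end

theory Submission
  imports Defs
begin

text \<open>
  Write \<open>C\<^sub>g\<close> for the essential supremum of \<open>sup f / g(f)\<close>. Pulling the max-linear functional \<open>R\<close>
  through the partial maximum, the stopping rule fails at step \<open>m\<close> iff
  \<open>r\<^sub>i \<Gamma>\<^sub>m\<^sub>+\<^sub>1 < \<Gamma>\<^sub>i\<close> for all \<open>i \<le> m\<close>, where \<open>\<Gamma>\<^sub>i = E\<^sub>1 + \<dots> + E\<^sub>i\<close> and the marks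
  \<open>r\<^sub>i = R(f\<^sub>i) / (g(f\<^sub>i) C\<^sub>g)\<close> are i.i.d. in \<open>[0,1]\<close>. Given \<open>\<Gamma>\<^sub>m\<^sub>+\<^sub>1\<close> the earlier arrival times are
  uniform order statistics, and averaging over the exchangeable marks removes the ordering, so
  the event has probability \<open>(1 - E r)\<^sup>m\<close>. Summing the geometric series, the expected
  number is \<open>C\<^sub>g / \<integral> R dH\<close>: whatever \<open>R\<close> is, one has to minimize \<open>C\<^sub>g\<close>. Integrating
  \<open>sup f \<le> C\<^sub>g g(f)\<close> gives \<open>C\<^sub>g \<ge> c\<close>, with equality iff \<open>g = sup f / c\<close> almost everywhere.
\<close>

section \<open>Exponential arrival times with independent marks\<close>

text \<open>The obstacle is that the level in every comparison is the last arrival time, which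
  contains all earlier waiting times. It is therefore first frozen at a number \<open>s\<close>.
  Each point then passes or fails on its own, and the joint density of the ordered arrival times
  depends only on the last of them. Conditioning and exchangeability reduce to one identity: the
  integral of a product over an ordered simplex is a power of the one-dimensional integral divided
  by a factorial. Only then is \<open>s\<close> replaced by the last arrival time, by integrating
  out the last waiting time alone.

  The quotient requires the integral of \<open>R\<close> to be finite and positive. Finiteness
  follows from \<open>R h \<le> sup_fun h\<close>. Positivity is where the assumption on the Poisson
  maximum enters; as \<open>T\<close> is only assumed to commute with finite maxima, the maximum
  must first be reduced to finitely many points.\<close>

text \<open>Fubini for independent blocks: given the coordinates in \<open>A\<close>, coordinate
  \<open>j\<close> keeps its own law. Used on one waiting time or one mark at a time, this takes the
  place of conditional distributions.\<close>

lemma (in prob_space) nn_integral_indep_coordinate: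
  fixes X :: "_ \<Rightarrow> _ \<Rightarrow> _ :: topological_space"
  assumes indep: "indep_vars (\<lambda>_. borel) X UNIV"
    and j: "j \<notin> A"
    and f[measurable]: "f \<in> borel_measurable (PiM A (\<lambda>_. borel) \<Otimes>\<^sub>M borel)"
  shows "(\<integral>\<^sup>+ \<omega>. f (restrict (\<lambda>i. X i \<omega>) A, X j \<omega>) \<partial>M)
       = (\<integral>\<^sup>+ \<omega>. (\<integral>\<^sup>+ y. f (restrict (\<lambda>i. X i \<omega>) A, y) \<partial>distr M borel (X j)) \<partial>M)"
proof -
  let ?V = "\<lambda>\<omega>. restrict (\<lambda>i. X i \<omega>) A"
  let ?W = "\<lambda>\<omega>. restrict (\<lambda>i. X i \<omega>) {j}"
  let ?K = "PiM {j} (\<lambda>_. borel)"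
  let ?N = "PiM A (\<lambda>_. borel)"
  have "indep_var ?N ?V ?K ?W"
    using indep j by (intro indep_var_restrict[where I=UNIV]) auto
  then have rv[measurable]: "?V \<in> M \<rightarrow>\<^sub>M ?N" "?W \<in> M \<rightarrow>\<^sub>M ?K"
    and d: "distr M ?N ?V \<Otimes>\<^sub>M distr M ?K ?W = distr M (?N \<Otimes>\<^sub>M ?K) (\<lambda>\<omega>. (?V \<omega>, ?W \<omega>))"
    by (simp_all add: indep_var_distribution_eq)
  have [measurable]: "X j \<in> borel_measurable M"
    using indep by (simp add: indep_vars_def)
  have [measurable]: "(\<lambda>w. w j) \<in> ?K \<rightarrow>\<^sub>M borel"
    by (rule measurable_component_singleton) simp
  interpret D: prob_space "distr M ?K ?W" by (rule prob_space_distr) simp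
  have "(\<integral>\<^sup>+ \<omega>. f (?V \<omega>, X j \<omega>) \<partial>M) = (\<integral>\<^sup>+ p. f (fst p, snd p j) \<partial>distr M (?N \<Otimes>\<^sub>M ?K) (\<lambda>\<omega>. (?V \<omega>, ?W \<omega>)))"
    by (subst nn_integral_distr) simp_all
  also have "\<dots> = (\<integral>\<^sup>+ p. f (fst p, snd p j) \<partial>(distr M ?N ?V \<Otimes>\<^sub>M distr M ?K ?W))"
    by (simp add: d)
  also have "\<dots> = (\<integral>\<^sup>+ v. (\<integral>\<^sup>+ w. f (v, w j) \<partial>distr M ?K ?W) \<partial>distr M ?N ?V)"
    by (subst D.nn_integral_fst[symmetric]) simp_all
  also have "\<dots> = (\<integral>\<^sup>+ \<omega>. (\<integral>\<^sup>+ w. f (?V \<omega>, w j) \<partial>distr M ?K ?W) \<partial>M)"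
    by (subst nn_integral_distr) simp_all
  also have "\<dots> = (\<integral>\<^sup>+ \<omega>. (\<integral>\<^sup>+ y. f (?V \<omega>, y) \<partial>distr M borel (X j)) \<partial>M)"
    by (intro nn_integral_cong) (simp add: nn_integral_distr)
  finally show ?thesis .
qed

text \<open>\<open>L x ^ Suc k\<close> integrates a product of values of \<open>G\<close> over a
  cube with side (0, x). Up to diagonals the cube splits into \<open>Suc k\<close> pieces of equal
  weight according to which variable is largest; if that variable is \<open>y\<close>, the others
  range over (0, y).\<close>

lemma nn_integral_power_of_integral:
  fixes G :: "real \<Rightarrow> ennreal"
  assumes [measurable]: "G \<in> borel_measurable borel"
  defines "L \<equiv> (\<lambda>x. \<integral>\<^sup>+ y. G y * indicator {0<..<x} y \<partial>lborel)"
  assumes fin: "\<And>x. L x < \<infinity>"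
  shows "of_nat (Suc k) * (\<integral>\<^sup>+ y. G y * L y ^ k * indicator {0<..<x} y \<partial>lborel) = L x ^ Suc k"
    and "L \<in> borel_measurable borel"
proof -
  show Lm[measurable]: "L \<in> borel_measurable borel"
    unfolding L_def indicator_def greaterThanLessThan_iff by measurable
  let ?J = "\<lambda>k x. \<integral>\<^sup>+ y. G y * L y ^ k * indicator {0<..<x} y \<partial>lborel"
  have "of_nat (Suc k) * ?J k x = L x ^ Suc k" for k x
  proof (induction k arbitrary: x)
    case 0
    show ?case by (simp add: L_def)
  next
    case (Suc k)
    have IH: "L z ^ Suc k = (\<integral>\<^sup>+ y. of_nat (Suc k) * (G y * L y ^ k * indicator {0<..<z} y) \<partial>lborel)" for z
      by (subst nn_integral_cmult) (simp_all only: Suc.IH, measurable)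
    \<comment> \<open>Here \<open>y\<close> is the added variable and \<open>z\<close> the largest
      of the earlier ones, with its weight from the induction hypothesis. The region
      \<open>z < y\<close> contributes one piece and \<open>y < z\<close> contributes
      \<open>Suc k\<close> equal ones.\<close>
    define a where "a = (\<lambda>y z. G y * indicator {0<..<x} y * (of_nat (Suc k) * (G z * L z ^ k * indicator {0<..<x} z)))"
    have [measurable]: "case_prod a \<in> borel_measurable (lborel \<Otimes>\<^sub>M lborel)"
      unfolding a_def by measurable
    have "L x ^ Suc (Suc k) = (\<integral>\<^sup>+ y. G y * indicator {0<..<x} y * L x ^ Suc k \<partial>lborel)"
      by (subst nn_integral_multc) (simp_all add: L_def)
    also have "\<dots> = (\<integral>\<^sup>+ y. (\<integral>\<^sup>+ z. a y z \<partial>lborel) \<partial>lborel)"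
      unfolding a_def by (subst IH, subst nn_integral_cmult[symmetric]) simp_all
    also have "\<dots> = (\<integral>\<^sup>+ y. (\<integral>\<^sup>+ z. (if z < y then a y z else 0) \<partial>lborel) + (\<integral>\<^sup>+ z. (if y < z then a y z else 0) \<partial>lborel) \<partial>lborel)"
    proof (intro nn_integral_cong)
      fix y :: real
      have "(\<integral>\<^sup>+ z. a y z \<partial>lborel) = (\<integral>\<^sup>+ z. (if z < y then a y z else 0) + (if y < z then a y z else 0) \<partial>lborel)"
        by (intro nn_integral_cong_AE, rule AE_mp[OF AE_lborel_singleton[of y]])
           (auto intro!: AE_I2 split: split_indicator)
      then show "(\<integral>\<^sup>+ z. a y z \<partial>lborel) = (\<integral>\<^sup>+ z. (if z < y then a y z else 0) \<partial>lborel) + (\<integral>\<^sup>+ z. (if y < z then a y z else 0) \<partial>lborel)"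
        by (simp add: nn_integral_add)
    qed
    also have "\<dots> = (\<integral>\<^sup>+ y. (\<integral>\<^sup>+ z. (if z < y then a y z else 0) \<partial>lborel) \<partial>lborel) + (\<integral>\<^sup>+ y. (\<integral>\<^sup>+ z. (if y < z then a y z else 0) \<partial>lborel) \<partial>lborel)"
      by (rule nn_integral_add) simp_all
    also have "(\<integral>\<^sup>+ y. (\<integral>\<^sup>+ z. (if y < z then a y z else 0) \<partial>lborel) \<partial>lborel) = (\<integral>\<^sup>+ z. (\<integral>\<^sup>+ y. (if y < z then a y z else 0) \<partial>lborel) \<partial>lborel)"
      by (rule lborel_pair.Fubini') simp
    also have "\<dots> = (\<integral>\<^sup>+ z. of_nat (Suc k) * (G z * L z ^ Suc k * indicator {0<..<x} z) \<partial>lborel)"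
    proof (intro nn_integral_cong)
      fix z :: real
      have "(\<integral>\<^sup>+ y. (if y < z then a y z else 0) \<partial>lborel)
          = (\<integral>\<^sup>+ y. (of_nat (Suc k) * (G z * L z ^ k * indicator {0<..<x} z)) * (G y * indicator {0<..<z} y) \<partial>lborel)"
        unfolding a_def by (intro nn_integral_cong) (auto simp: mult_ac split: split_indicator)
      also have "\<dots> = of_nat (Suc k) * (G z * L z ^ k * indicator {0<..<x} z) * L z"
        unfolding L_def by (subst nn_integral_cmult) simp_all
      finally show "(\<integral>\<^sup>+ y. (if y < z then a y z else 0) \<partial>lborel) = of_nat (Suc k) * (G z * L z ^ Suc k * indicator {0<..<x} z)"
        by (simp add: mult_ac)
    qed
    also have "(\<integral>\<^sup>+ y. (\<integral>\<^sup>+ z. (if z < y then a y z else 0) \<partial>lborel) \<partial>lborel) = (\<integral>\<^sup>+ y. G y * L y ^ Suc k * indicator {0<..<x} y \<partial>lborel)"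
    proof (intro nn_integral_cong)
      fix y :: real
      have "(\<integral>\<^sup>+ z. (if z < y then a y z else 0) \<partial>lborel)
          = (\<integral>\<^sup>+ z. G y * indicator {0<..<x} y * (of_nat (Suc k) * (G z * L z ^ k * indicator {0<..<y} z)) \<partial>lborel)"
        unfolding a_def by (intro nn_integral_cong) (auto simp: mult_ac split: split_indicator)
      also have "\<dots> = G y * indicator {0<..<x} y * L y ^ Suc k"
        by (subst nn_integral_cmult) (simp_all only: IH, measurable)
      finally show "(\<integral>\<^sup>+ z. (if z < y then a y z else 0) \<partial>lborel) = G y * L y ^ Suc k * indicator {0<..<x} y"
        by (simp add: mult_ac)
    qed
    also have "(\<integral>\<^sup>+ z. of_nat (Suc k) * (G z * L z ^ Suc k * indicator {0<..<x} z) \<partial>lborel) = of_nat (Suc k) * ?J (Suc k) x"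
      by (rule nn_integral_cmult) simp
    finally show ?case
      by (simp only: of_nat_Suc[of "Suc k"] distrib_right mult_1)
  qed
  then show "of_nat (Suc k) * ?J k x = L x ^ Suc k" .
qed

text \<open>
  In \<open>v :: nat + nat \<Rightarrow> real\<close> the left summand indexes waiting times and the right one marks.
\<close>

definition arrival_time :: "nat \<Rightarrow> (nat + nat \<Rightarrow> real) \<Rightarrow> real" where
  "arrival_time k v = (\<Sum>j<k. v (Inl j))"

text \<open>The level \<open>s\<close> is separate from \<open>v\<close> so that it can be frozen,
  although it is later set to \<open>arrival_time (Suc m) v\<close>. The product of 0-1 factors lets
  the newest point be split off.\<close>

definition late_arrivals :: "nat \<Rightarrow> (nat + nat \<Rightarrow> real) \<Rightarrow> real \<Rightarrow> ennreal" where
  "late_arrivals k v s = (\<Prod>i<k. if v (Inr i) * s < arrival_time (Suc i) v then 1 else 0)"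

lemma arrival_time_restrict:
  "Inl ` {..<k} \<subseteq> A \<Longrightarrow> arrival_time k (restrict v A) = arrival_time k v"
  unfolding arrival_time_def by (intro sum.cong) auto

lemma late_arrivals_restrict:
  assumes "Inl ` {..<k} \<subseteq> A" "Inr ` {..<k} \<subseteq> A"
  shows "late_arrivals k (restrict v A) s = late_arrivals k v s"
  unfolding late_arrivals_def
proof (intro prod.cong refl)
  fix i assume "i \<in> {..<k}"
  then have "Inl ` {..<Suc i} \<subseteq> A" "Inr i \<in> A"
    using assms by auto
  then show "(if restrict v A (Inr i) * s < arrival_time (Suc i) (restrict v A) then 1 else 0)
           = (if v (Inr i) * s < arrival_time (Suc i) v then 1 else (0::ennreal))"
    by (simp add: arrival_time_restrict)
qed

lemma measurable_arrival_time:
  assumes "Inl ` {..<k} \<subseteq> A"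
  shows "arrival_time k \<in> borel_measurable (PiM A (\<lambda>_. borel))"
  unfolding arrival_time_def
  using assms by (intro borel_measurable_sum measurable_component_singleton) auto

lemma measurable_late_arrivals:
  assumes "Inl ` {..<k} \<subseteq> A" "Inr ` {..<k} \<subseteq> A"
  shows "(\<lambda>(v, s). late_arrivals k v s) \<in> borel_measurable (PiM A (\<lambda>_. borel) \<Otimes>\<^sub>M borel)"
  unfolding late_arrivals_def split_beta
proof (intro borel_measurable_prod_ennreal)
  fix i assume "i \<in> {..<k}"
  then have "Inl ` {..<Suc i} \<subseteq> A" "Inr i \<in> A"
    using assms by auto
  then have [measurable]: "arrival_time (Suc i) \<in> borel_measurable (PiM A (\<lambda>_. borel))"
    "(\<lambda>v. v (Inr i)) \<in> borel_measurable (PiM A (\<lambda>_. borel :: real measure))"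
    by (intro measurable_arrival_time measurable_component_singleton; simp)+
  show "(\<lambda>p. if fst p (Inr i) * snd p < arrival_time (Suc i) (fst p) then 1 else 0)
    \<in> borel_measurable (PiM A (\<lambda>_. borel) \<Otimes>\<^sub>M borel)"
    by measurable
qed

section \<open>Thinned arrivals below a level\<close>

locale marked_arrivals = prob_space M for M :: "'w measure" +
  fixes X :: "nat + nat \<Rightarrow> 'w \<Rightarrow> real" and \<nu> :: "real measure"
  assumes indep: "indep_vars (\<lambda>_. borel) X UNIV"
    and expo: "distributed M lborel (X (Inl j)) (exponential_density 1)"
    and mark: "distr M borel (X (Inr i)) = \<nu>"
    and mark_bounds: "AE y in \<nu>. 0 \<le> y \<and> y \<le> 1"
begin

text \<open>Thinning of a unit-rate Poisson process: a point arriving at time \<open>x\<close>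
  passes the test at level \<open>s\<close> with probability \<open>G s x\<close>, and
  \<open>L s x\<close> below is the mean number of passing points before time
  \<open>x\<close>.\<close>

definition G :: "real \<Rightarrow> real \<Rightarrow> ennreal" where
  "G s x = emeasure \<nu> {y. y * s < x}"

definition L :: "real \<Rightarrow> real \<Rightarrow> ennreal" where
  "L s x = (\<integral>\<^sup>+ y. G s y * indicator {0<..<x} y \<partial>lborel)"

abbreviation V :: "'w \<Rightarrow> nat + nat \<Rightarrow> real" where
  "V \<omega> \<equiv> (\<lambda>i. X i \<omega>)"

lemma X_measurable[measurable]: "X i \<in> borel_measurable M"
  using indep by (simp add: indep_vars_def)

lemma sets_mark[measurable_cong, simp]: "sets \<nu> = sets borel"
  using mark[of 0] by (metis sets_distr)

lemma space_mark[simp]: "space \<nu> = UNIV"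
  using sets_eq_imp_space_eq[OF sets_mark] by simp

sublocale marks: prob_space \<nu>
  using prob_space_distr[of "X (Inr 0)" borel] mark[of 0] by simp

lemma G_eq: "G s x = (\<integral>\<^sup>+ y. (if y * s < x then 1 else 0) \<partial>\<nu>)"
proof -
  have "G s x = (\<integral>\<^sup>+ y. indicator {y. y * s < x} y \<partial>\<nu>)"
    unfolding G_def by (subst nn_integral_indicator) simp_all
  then show ?thesis
    by (simp add: indicator_def of_bool_def)
qed

lemma G_measurable[measurable]: "G s \<in> borel_measurable borel"
proof -
  have "(\<lambda>x. \<integral>\<^sup>+ y. (if y * s < x then 1 else 0) \<partial>\<nu>) \<in> borel_measurable borel"
    by measurable
  then show ?thesis
    by (simp add: G_eq[abs_def])
qed

lemma L_finite: "L s x < \<infinity>"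
proof -
  have "L s x \<le> (\<integral>\<^sup>+ y. indicator {0<..<x} y \<partial>lborel)"
    unfolding L_def by (intro nn_integral_mono) (auto simp: G_def marks.emeasure_le_1 split: split_indicator)
  also have "\<dots> < \<infinity>"
    by (cases "0 \<le> x") simp_all
  finally show ?thesis .
qed

lemma L_measurable[measurable]: "L s \<in> borel_measurable borel"
  and L_power: "of_nat (Suc k) * (\<integral>\<^sup>+ y. G s y * L s y ^ k * indicator {0<..<x} y \<partial>lborel) = L s x ^ Suc k"
  using nn_integral_power_of_integral[of "G s"] L_finite by (simp_all add: L_def[abs_def])

text \<open>The density is expressed in absolute time \<open>x = a + e\<close>, so that the factors
  \<open>exp (a - x)\<close> of successive waiting times telescope.\<close>

lemma nn_integral_exponential:
  assumes [measurable]: "f \<in> borel_measurable borel"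
  shows "(\<integral>\<^sup>+ e. f (a + e) \<partial>distr M borel (X (Inl j)))
       = (\<integral>\<^sup>+ x. (if a < x then ennreal (exp (a - x)) * f x else 0) \<partial>lborel)"
proof -
  have "distr M borel (X (Inl j)) = distr M lborel (X (Inl j))"
    by (intro distr_cong) simp_all
  then have "distr M borel (X (Inl j)) = density lborel (\<lambda>x. ennreal (exponential_density 1 x))"
    using expo[of j] by (simp add: distributed_def)
  then have "(\<integral>\<^sup>+ e. f (a + e) \<partial>distr M borel (X (Inl j)))
    = (\<integral>\<^sup>+ e. ennreal (exponential_density 1 e) * f (a + e) \<partial>lborel)"
    by (simp add: nn_integral_density)
  also have "\<dots> = (\<integral>\<^sup>+ e. (if a < a + e then ennreal (exp (a - (a + e))) * f (a + e) else 0) \<partial>lborel)"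
    by (intro nn_integral_cong_AE, rule AE_mp[OF AE_lborel_singleton[of 0]])
       (auto intro!: AE_I2 simp: exponential_density_def)
  also have "\<dots> = (\<integral>\<^sup>+ x. (if a < x then ennreal (exp (a - x)) * f x else 0) \<partial>lborel)"
    by (subst nn_integral_real_affine[where c=1 and t=a, of "\<lambda>x. if a < x then ennreal (exp (a - x)) * f x else 0"])
       (simp_all cong: if_cong)
  finally show ?thesis .
qed

lemma arrival_time_measurable[measurable]: "(\<lambda>\<omega>. arrival_time k (V \<omega>)) \<in> borel_measurable M"
  unfolding arrival_time_def by measurable

lemma late_arrivals_measurable[measurable]:
  "(\<lambda>p. late_arrivals k (V (fst p)) (snd p)) \<in> borel_measurable (M \<Otimes>\<^sub>M borel)"
  unfolding late_arrivals_def by measurable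

lemma late_arrivals_measurable1[measurable (raw)]:
  assumes [measurable]: "f \<in> N \<rightarrow>\<^sub>M M" "g \<in> borel_measurable N"
  shows "(\<lambda>z. late_arrivals k (V (f z)) (g z)) \<in> borel_measurable N"
  using measurable_compose[OF measurable_Pair[OF assms] late_arrivals_measurable, of k] by simp

text \<open>Mark \<open>k\<close> occurs only in the newest factor, so it is integrated out first
  and yields \<open>G s\<close>. After that, waiting time \<open>k\<close> occurs only through
  \<open>arrival_time (Suc k)\<close> and is integrated out too. What remains is again a function of
  \<open>arrival_time k\<close>; the free \<open>\<phi>\<close> is what makes the step
  iterable.\<close>

lemma late_arrivals_step:
  assumes \<phi>[measurable]: "\<phi> \<in> borel_measurable borel"
  shows "(\<integral>\<^sup>+ \<omega>. late_arrivals (Suc k) (V \<omega>) s * \<phi> (arrival_time (Suc k) (V \<omega>)) \<partial>M)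
       = (\<integral>\<^sup>+ \<omega>. late_arrivals k (V \<omega>) s *
            (\<integral>\<^sup>+ x. (if arrival_time k (V \<omega>) < x then ennreal (exp (arrival_time k (V \<omega>) - x)) * (\<phi> x * G s x) else 0) \<partial>lborel) \<partial>M)"
proof -
  let ?A = "Inl ` {..<Suc k} \<union> Inr ` {..<k} :: (nat + nat) set"
  let ?B = "Inl ` {..<k} \<union> Inr ` {..<k} :: (nat + nat) set"
  let ?P = "\<lambda>A. PiM A (\<lambda>_. borel :: real measure)"
  have [measurable]: "arrival_time (Suc k) \<in> borel_measurable (?P ?A)" "arrival_time k \<in> borel_measurable (?P ?B)"
    by (rule measurable_arrival_time; blast)+
  have m: "(\<lambda>v. late_arrivals k v s) \<in> borel_measurable (?P A)" if "?B \<subseteq> A" for A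
    using that measurable_Pair1[OF measurable_late_arrivals[of k A], of s] by simp
  have [measurable]: "(\<lambda>v. late_arrivals k v s) \<in> borel_measurable (?P ?A)"
    "(\<lambda>v. late_arrivals k v s) \<in> borel_measurable (?P ?B)"
    by (rule m; auto)+
  define f where "f = (\<lambda>(v, y). late_arrivals k v s * \<phi> (arrival_time (Suc k) v) *
     (if y * s < arrival_time (Suc k) v then 1 else 0 :: ennreal))"
  define h where "h = (\<lambda>(v, e). late_arrivals k v s * (\<phi> (arrival_time k v + e) * G s (arrival_time k v + e)))"
  have [measurable]: "f \<in> borel_measurable (?P ?A \<Otimes>\<^sub>M borel)" "h \<in> borel_measurable (?P ?B \<Otimes>\<^sub>M borel)"
    unfolding f_def h_def by measurable
  have rA: "late_arrivals k (restrict v ?A) s = late_arrivals k v s" "arrival_time (Suc k) (restrict v ?A) = arrival_time (Suc k) v"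
    and rB: "late_arrivals k (restrict v ?B) s = late_arrivals k v s" "arrival_time k (restrict v ?B) = arrival_time k v" for v
    by (auto intro!: late_arrivals_restrict arrival_time_restrict)
  have "(\<integral>\<^sup>+ \<omega>. late_arrivals (Suc k) (V \<omega>) s * \<phi> (arrival_time (Suc k) (V \<omega>)) \<partial>M)
      = (\<integral>\<^sup>+ \<omega>. f (restrict (V \<omega>) ?A, X (Inr k) \<omega>) \<partial>M)"
    by (intro nn_integral_cong) (simp only: f_def split rA, simp add: late_arrivals_def mult_ac)
  also have "\<dots> = (\<integral>\<^sup>+ \<omega>. (\<integral>\<^sup>+ y. f (restrict (V \<omega>) ?A, y) \<partial>\<nu>) \<partial>M)"
    by (subst nn_integral_indep_coordinate[OF indep]) (auto simp: mark)
  also have "\<dots> = (\<integral>\<^sup>+ \<omega>. h (restrict (V \<omega>) ?B, X (Inl k) \<omega>) \<partial>M)"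
  proof (intro nn_integral_cong)
    fix \<omega>
    have "(\<integral>\<^sup>+ y. f (restrict (V \<omega>) ?A, y) \<partial>\<nu>)
      = late_arrivals k (V \<omega>) s * \<phi> (arrival_time (Suc k) (V \<omega>)) * G s (arrival_time (Suc k) (V \<omega>))"
      unfolding G_eq by (subst nn_integral_cmult[symmetric]) (simp_all only: f_def split rA, measurable)
    also have "arrival_time (Suc k) (V \<omega>) = arrival_time k (V \<omega>) + X (Inl k) \<omega>"
      by (simp add: arrival_time_def)
    finally show "(\<integral>\<^sup>+ y. f (restrict (V \<omega>) ?A, y) \<partial>\<nu>) = h (restrict (V \<omega>) ?B, X (Inl k) \<omega>)"
      by (simp only: h_def split rB mult_ac)
  qed
  also have "\<dots> = (\<integral>\<^sup>+ \<omega>. (\<integral>\<^sup>+ e. h (restrict (V \<omega>) ?B, e) \<partial>distr M borel (X (Inl k))) \<partial>M)"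
    by (rule nn_integral_indep_coordinate[OF indep]) auto
  also have "\<dots> = (\<integral>\<^sup>+ \<omega>. late_arrivals k (V \<omega>) s *
            (\<integral>\<^sup>+ x. (if arrival_time k (V \<omega>) < x then ennreal (exp (arrival_time k (V \<omega>) - x)) * (\<phi> x * G s x) else 0) \<partial>lborel) \<partial>M)"
    by (intro nn_integral_cong, subst nn_integral_exponential[symmetric])
       (simp, simp only: h_def split rB, subst nn_integral_cmult, simp_all)
  finally show ?thesis .
qed

text \<open>The first \<open>Suc k\<close> arrival times have joint density \<open>exp (- x)\<close>
  on the ordered simplex, \<open>x\<close> being the last of them. Each mark contributes a factor
  \<open>G s\<close>, and integrating the \<open>k\<close> earlier times over the simplex below
  \<open>x\<close> gives \<open>L s x ^ k / fact k\<close>.\<close>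

lemma late_arrivals_fixed_level:
  assumes \<phi>[measurable]: "\<phi> \<in> borel_measurable borel"
  shows "of_nat (fact k) * (\<integral>\<^sup>+ \<omega>. late_arrivals (Suc k) (V \<omega>) s * \<phi> (arrival_time (Suc k) (V \<omega>)) \<partial>M)
       = (\<integral>\<^sup>+ x. (if 0 < x then \<phi> x * ennreal (exp (- x)) * G s x * L s x ^ k else 0) \<partial>lborel)"
  using \<phi>
proof (induction k arbitrary: \<phi>)
  case 0
  note [measurable] = 0
  show ?case
    by (subst late_arrivals_step)
       (auto simp: late_arrivals_def arrival_time_def emeasure_space_1 mult_ac cong: if_cong intro!: nn_integral_cong)
next
  case (Suc k)
  note [measurable] = Suc.prems
  \<comment> \<open>The effect of the newest point, as a function of the previous arrival time; this
    is the test function for the induction hypothesis.\<close>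
  define \<psi> where "\<psi> = (\<lambda>y. \<integral>\<^sup>+ x. (if y < x then ennreal (exp (y - x)) * (\<phi> x * G s x) else 0) \<partial>lborel)"
  have \<psi>[measurable]: "\<psi> \<in> borel_measurable borel"
    unfolding \<psi>_def by measurable
  let ?c = "\<lambda>x. \<phi> x * ennreal (exp (- x)) * G s x"
  have "of_nat (fact (Suc k)) * (\<integral>\<^sup>+ \<omega>. late_arrivals (Suc (Suc k)) (V \<omega>) s * \<phi> (arrival_time (Suc (Suc k)) (V \<omega>)) \<partial>M)
      = of_nat (Suc k) * (of_nat (fact k) * (\<integral>\<^sup>+ \<omega>. late_arrivals (Suc k) (V \<omega>) s * \<psi> (arrival_time (Suc k) (V \<omega>)) \<partial>M))"
    by (subst late_arrivals_step) (simp, simp only: \<psi>_def fact_Suc of_nat_mult of_nat_id mult_ac)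
  also have "\<dots> = of_nat (Suc k) * (\<integral>\<^sup>+ y. (if 0 < y then \<psi> y * ennreal (exp (- y)) * G s y * L s y ^ k else 0) \<partial>lborel)"
    by (simp only: Suc.IH[OF \<psi>])
  also have "(\<integral>\<^sup>+ y. (if 0 < y then \<psi> y * ennreal (exp (- y)) * G s y * L s y ^ k else 0) \<partial>lborel)
     = (\<integral>\<^sup>+ y. (\<integral>\<^sup>+ x. (if 0 < y \<and> y < x then ?c x * (G s y * L s y ^ k) else 0) \<partial>lborel) \<partial>lborel)"
  proof (intro nn_integral_cong)
    fix y :: real
    have "\<psi> y * (ennreal (exp (- y)) * G s y * L s y ^ k)
        = (\<integral>\<^sup>+ x. (if y < x then ennreal (exp (y - x)) * (\<phi> x * G s x) else 0) * (ennreal (exp (- y)) * G s y * L s y ^ k) \<partial>lborel)"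
      unfolding \<psi>_def by (rule nn_integral_multc[symmetric]) simp
    also have "\<dots> = (\<integral>\<^sup>+ x. (if y < x then ?c x * (G s y * L s y ^ k) else 0) \<partial>lborel)"
    proof (intro nn_integral_cong)
      fix x :: real
      have "ennreal (exp (y - x)) * (\<phi> x * G s x) * (ennreal (exp (- y)) * G s y * L s y ^ k)
          = \<phi> x * (ennreal (exp (y - x)) * ennreal (exp (- y))) * G s x * (G s y * L s y ^ k)"
        by (simp only: mult_ac)
      also have "ennreal (exp (y - x)) * ennreal (exp (- y)) = ennreal (exp (- x))"
        by (simp add: ennreal_mult'[symmetric] exp_add[symmetric])
      finally show "(if y < x then ennreal (exp (y - x)) * (\<phi> x * G s x) else 0) * (ennreal (exp (- y)) * G s y * L s y ^ k)
           = (if y < x then ?c x * (G s y * L s y ^ k) else 0)"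
        by simp
    qed
    finally show "(if 0 < y then \<psi> y * ennreal (exp (- y)) * G s y * L s y ^ k else 0)
        = (\<integral>\<^sup>+ x. (if 0 < y \<and> y < x then ?c x * (G s y * L s y ^ k) else 0) \<partial>lborel)"
      by (simp add: mult_ac)
  qed
  \<comment> \<open>With the last time \<open>x\<close> outermost, \<open>L_power\<close> evaluates
    the inner integral. The factor \<open>Suc k\<close> that it needs is the quotient of
    \<open>fact (Suc k)\<close> and \<open>fact k\<close>.\<close>
  also have "\<dots> = (\<integral>\<^sup>+ x. (\<integral>\<^sup>+ y. (if 0 < y \<and> y < x then ?c x * (G s y * L s y ^ k) else 0) \<partial>lborel) \<partial>lborel)"
    by (rule lborel_pair.Fubini') measurable
  also have "\<dots> = (\<integral>\<^sup>+ x. ?c x * (\<integral>\<^sup>+ y. G s y * L s y ^ k * indicator {0<..<x} y \<partial>lborel) \<partial>lborel)"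
    by (intro nn_integral_cong, subst nn_integral_cmult[symmetric])
       (auto intro!: nn_integral_cong)
  also have "of_nat (Suc k) * \<dots> = (\<integral>\<^sup>+ x. ?c x * (of_nat (Suc k) * (\<integral>\<^sup>+ y. G s y * L s y ^ k * indicator {0<..<x} y \<partial>lborel)) \<partial>lborel)"
    by (subst nn_integral_cmult[symmetric]) (simp_all add: indicator_def mult_ac cong: if_cong)
  also have "\<dots> = (\<integral>\<^sup>+ x. ?c x * L s x ^ Suc k \<partial>lborel)"
    by (simp only: L_power)
  also have "\<dots> = (\<integral>\<^sup>+ x. (if 0 < x then ?c x * L s x ^ Suc k else 0) \<partial>lborel)"
    by (intro nn_integral_cong) (auto simp: L_def)
  finally show ?case .
qed

definition q :: ennreal where
  "q = (\<integral>\<^sup>+ y. ennreal (1 - y) \<partial>\<nu>)"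

text \<open>Before time \<open>s\<close>, a point with mark \<open>y\<close> passes exactly when it
  arrives in an interval of length \<open>s * (1 - y)\<close>; here the bounds on the marks enter.
  So \<open>q\<close> is the probability that a uniform point on (0, s) passes, whatever
  \<open>s\<close> is.\<close>

lemma L_diagonal:
  assumes s: "0 < s"
  shows "L s s = ennreal s * q"
proof -
  interpret pair_sigma_finite lborel \<nu> ..
  have "L s s = (\<integral>\<^sup>+ x. (\<integral>\<^sup>+ y. (if y * s < x \<and> 0 < x \<and> x < s then 1 else 0) \<partial>\<nu>) \<partial>lborel)"
    unfolding L_def
  proof (intro nn_integral_cong)
    fix x
    show "G s x * indicator {0<..<s} x = (\<integral>\<^sup>+ y. (if y * s < x \<and> 0 < x \<and> x < s then 1 else 0) \<partial>\<nu>)"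
      unfolding G_eq by (auto split: split_indicator)
  qed
  also have "\<dots> = (\<integral>\<^sup>+ y. (\<integral>\<^sup>+ x. (if y * s < x \<and> 0 < x \<and> x < s then 1 else 0) \<partial>lborel) \<partial>\<nu>)"
    by (rule Fubini'[symmetric]) measurable
  also have "\<dots> = (\<integral>\<^sup>+ y. ennreal s * ennreal (1 - y) \<partial>\<nu>)"
  proof (intro nn_integral_cong_AE, rule AE_mp[OF mark_bounds], intro AE_I2 impI)
    fix y :: real assume y: "0 \<le> y \<and> y \<le> 1"
    then have ys: "0 \<le> y * s" "y * s \<le> s"
      using s by (auto intro: mult_left_le_one_le)
    then have "(\<integral>\<^sup>+ x. (if y * s < x \<and> 0 < x \<and> x < s then 1 else 0) \<partial>lborel) = (\<integral>\<^sup>+ x. indicator {y * s<..<s} x \<partial>lborel)"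
      by (intro nn_integral_cong) (auto split: split_indicator)
    also have "\<dots> = ennreal (s - y * s)"
      using ys by simp
    also have "s - y * s = s * (1 - y)"
      by (simp add: algebra_simps)
    finally show "(\<integral>\<^sup>+ x. (if y * s < x \<and> 0 < x \<and> x < s then 1 else 0) \<partial>lborel) = ennreal s * ennreal (1 - y)"
      using s y by (simp add: ennreal_mult)
  qed
  also have "\<dots> = ennreal s * q"
    unfolding q_def by (subst nn_integral_cmult) simp_all
  finally show ?thesis .
qed

text \<open>Waiting time \<open>m\<close> is independent of the first \<open>m\<close> points, so
  integrating it out turns the random level into a number \<open>x\<close>. The fixed-level formula,
  with level and endpoint both equal to \<open>x\<close>, then gives
  \<open>exp (- x) * (x * q) ^ m / fact m\<close>, and the Gamma integral cancels the
  factorial.\<close>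

lemma expected_late_arrivals:
  "(\<integral>\<^sup>+ \<omega>. late_arrivals m (V \<omega>) (arrival_time (Suc m) (V \<omega>)) \<partial>M) = q ^ m"
proof -
  let ?A = "Inl ` {..<m} \<union> Inr ` {..<m} :: (nat + nat) set"
  let ?P = "PiM ?A (\<lambda>_. borel :: real measure)"
  have [measurable]: "arrival_time m \<in> borel_measurable ?P"
    by (rule measurable_arrival_time) blast
  have "(\<lambda>(v, s). late_arrivals m v s) \<in> borel_measurable (?P \<Otimes>\<^sub>M borel)"
    by (rule measurable_late_arrivals) auto
  moreover have "(\<lambda>p. (fst p, arrival_time m (fst p) + snd p)) \<in> ?P \<Otimes>\<^sub>M borel \<rightarrow>\<^sub>M ?P \<Otimes>\<^sub>M borel"
    by measurable
  ultimately have f: "(\<lambda>p. late_arrivals m (fst p) (arrival_time m (fst p) + snd p)) \<in> borel_measurable (?P \<Otimes>\<^sub>M borel)"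
    by (auto dest: measurable_compose[rotated])
  have r: "late_arrivals m (restrict v ?A) s = late_arrivals m v s" "arrival_time m (restrict v ?A) = arrival_time m v" for v s
    by (auto intro!: late_arrivals_restrict arrival_time_restrict)
  interpret lm: pair_sigma_finite lborel M ..
  let ?K = "\<lambda>x. \<integral>\<^sup>+ \<omega>. late_arrivals m (V \<omega>) x * (if arrival_time m (V \<omega>) < x then ennreal (exp (arrival_time m (V \<omega>) - x)) else 0) \<partial>M"
  have "(\<integral>\<^sup>+ \<omega>. late_arrivals m (V \<omega>) (arrival_time (Suc m) (V \<omega>)) \<partial>M)
    = (\<integral>\<^sup>+ \<omega>. (\<integral>\<^sup>+ e. late_arrivals m (V \<omega>) (arrival_time m (V \<omega>) + e) \<partial>distr M borel (X (Inl m))) \<partial>M)"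
    using nn_integral_indep_coordinate[OF indep _ f, of "Inl m"]
    by (simp add: r image_iff) (simp add: arrival_time_def)
  also have "\<dots> = (\<integral>\<^sup>+ \<omega>. (\<integral>\<^sup>+ x. late_arrivals m (V \<omega>) x * (if arrival_time m (V \<omega>) < x then ennreal (exp (arrival_time m (V \<omega>) - x)) else 0) \<partial>lborel) \<partial>M)"
  proof (intro nn_integral_cong)
    fix \<omega> assume [simp]: "\<omega> \<in> space M"
    have "(\<lambda>s. late_arrivals m (V \<omega>) s) \<in> borel_measurable borel"
      by measurable
    from nn_integral_exponential[OF this]
    show "(\<integral>\<^sup>+ e. late_arrivals m (V \<omega>) (arrival_time m (V \<omega>) + e) \<partial>distr M borel (X (Inl m)))
      = (\<integral>\<^sup>+ x. late_arrivals m (V \<omega>) x * (if arrival_time m (V \<omega>) < x then ennreal (exp (arrival_time m (V \<omega>) - x)) else 0) \<partial>lborel)"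
      by (auto intro!: nn_integral_cong simp: mult_ac)
  qed
  also have "\<dots> = (\<integral>\<^sup>+ x. ?K x \<partial>lborel)"
    by (rule lm.Fubini') measurable
  also have "fact m * \<dots> = (\<integral>\<^sup>+ x. fact m * ?K x \<partial>lborel)"
    by (rule nn_integral_cmult[symmetric]) measurable
  also have "\<dots> = (\<integral>\<^sup>+ x. q ^ m * (ennreal (x ^ m * exp (- x)) * indicator {0..} x) \<partial>lborel)"
  proof (intro nn_integral_cong_AE, rule AE_mp[OF AE_lborel_singleton[of 0]], intro AE_I2 impI)
    fix x :: real assume "x \<noteq> 0"
    \<comment> \<open>The fixed-level formula needs a last point, of index \<open>m - 1\<close>,
      which is why \<open>m = 0\<close> is separate.\<close>
    have "fact m * ?K x = (if 0 < x then ennreal (exp (- x)) * L x x ^ m else 0)"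
    proof (cases m)
      case 0
      then show ?thesis
        by (simp add: late_arrivals_def arrival_time_def emeasure_space_1)
    next
      case (Suc k)
      \<comment> \<open>The test function is the density at \<open>x\<close> of the next arrival
        after time \<open>y\<close>.\<close>
      have "fact (Suc k) * (\<integral>\<^sup>+ \<omega>. late_arrivals (Suc k) (V \<omega>) x *
            (if arrival_time (Suc k) (V \<omega>) < x then ennreal (exp (arrival_time (Suc k) (V \<omega>) - x)) else 0) \<partial>M)
          = of_nat (Suc k) * (\<integral>\<^sup>+ y. (if 0 < y then (if y < x then ennreal (exp (y - x)) else 0) * ennreal (exp (- y)) * G x y * L x y ^ k else 0) \<partial>lborel)"
        by (subst late_arrivals_fixed_level[where \<phi>="\<lambda>y. if y < x then ennreal (exp (y - x)) else 0", symmetric])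
           (simp, simp only: fact_Suc of_nat_mult of_nat_id of_nat_fact mult.assoc)
      also have "(\<integral>\<^sup>+ y. (if 0 < y then (if y < x then ennreal (exp (y - x)) else 0) * ennreal (exp (- y)) * G x y * L x y ^ k else 0) \<partial>lborel)
          = (\<integral>\<^sup>+ y. ennreal (exp (- x)) * (G x y * L x y ^ k * indicator {0<..<x} y) \<partial>lborel)"
        by (intro nn_integral_cong)
           (auto simp: ennreal_mult'[symmetric] exp_add[symmetric] mult.assoc[symmetric] split: split_indicator)
      also have "\<dots> = ennreal (exp (- x)) * (\<integral>\<^sup>+ y. G x y * L x y ^ k * indicator {0<..<x} y \<partial>lborel)"
        by (rule nn_integral_cmult) simp
      also have "of_nat (Suc k) * \<dots> = ennreal (exp (- x)) * L x x ^ Suc k"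
        by (subst L_power[symmetric]) (simp only: mult_ac)
      also have "\<dots> = (if 0 < x then ennreal (exp (- x)) * L x x ^ Suc k else 0)"
        by (auto simp: L_def)
      finally show ?thesis
        by (simp only: Suc)
    qed
    also have "\<dots> = q ^ m * (ennreal (x ^ m * exp (- x)) * indicator {0..} x)"
      using \<open>x \<noteq> 0\<close> by (auto simp: L_diagonal power_mult_distrib ennreal_mult' ennreal_power mult_ac split: split_indicator)
    finally show "fact m * ?K x = q ^ m * (ennreal (x ^ m * exp (- x)) * indicator {0..} x)" .
  qed
  also have "\<dots> = q ^ m * ennreal (fact m)"
    by (subst nn_integral_cmult) (simp_all add: nn_intergal_power_times_exp_Ici)
  also have "ennreal (fact m) = fact m"
    by (metis ennreal_of_nat_eq_real_of_nat of_nat_fact)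
  finally have eq: "fact m * (\<integral>\<^sup>+ \<omega>. late_arrivals m (V \<omega>) (arrival_time (Suc m) (V \<omega>)) \<partial>M) = fact m * q ^ m"
    by (simp add: mult.commute)
  have "(fact m :: ennreal) = of_nat (fact m)"
    by simp
  then have "(fact m :: ennreal) \<noteq> 0" "(fact m :: ennreal) \<noteq> \<top>"
    by (metis of_nat_eq_0_iff fact_nonzero, metis ennreal_of_nat_neq_top)
  with eq show ?thesis
    by (simp add: ennreal_mult_cancel_left)
qed

end

lemma late_arrivals_eq:
  "late_arrivals k v s = (if \<forall>i<k. v (Inr i) * s < arrival_time (Suc i) v then 1 else 0)"
  by (induction k) (auto simp: late_arrivals_def less_Suc_eq)

section \<open>Essential suprema and max-linear functionals\<close>

text \<open>Tail-sum formula on a single path: as \<open>B\<close> is downward closed, its first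
  failure is the number of indices where it holds. Index 0 is counted, which matches the range
  \<open>1 \<le> m\<close> of the minimum. If \<open>B\<close> never fails, both sides are
  infinite.\<close>

lemma INF_first_failure_eq_suminf:
  fixes B :: "nat \<Rightarrow> bool"
  assumes "B 0" and mono: "\<And>m. B (Suc m) \<Longrightarrow> B m"
  shows "(INF m\<in>{m. 1 \<le> m \<and> \<not> B m}. of_nat m) = (\<Sum>m. if B m then 1 else 0 :: ennreal)"
proof (cases "\<forall>m. B m")
  case True
  have "(\<Sum>m::nat. ennreal 1) = \<top>"
    using summable_suminf_not_top[of "\<lambda>_. 1"] by (auto simp: summable_const_iff)
  then show ?thesis using True by simp
next
  case False
  define n where "n = (LEAST m. \<not> B m)"
  have n: "\<not> B n" "\<And>m. m < n \<Longrightarrow> B m"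
    unfolding n_def using False LeastI_ex[of "\<lambda>m. \<not> B m"] by (auto dest: not_less_Least)
  have ge: "\<not> B m" if "n \<le> m" for m
    using that by (induction rule: dec_induct) (use n mono in auto)
  have "1 \<le> n"
    using \<open>B 0\<close> n(1) by (cases n) auto
  have "(INF m\<in>{m. 1 \<le> m \<and> \<not> B m}. of_nat m) = (of_nat n :: ennreal)"
  proof (rule antisym)
    show "(INF m\<in>{m. 1 \<le> m \<and> \<not> B m}. of_nat m) \<le> (of_nat n :: ennreal)"
      using n \<open>1 \<le> n\<close> by (intro INF_lower) auto
    show "of_nat n \<le> (INF m\<in>{m. 1 \<le> m \<and> \<not> B m}. of_nat m :: ennreal)"
      using n(2) by (intro INF_greatest) (auto simp: not_less[symmetric])
  qed
  also have "\<dots> = (\<Sum>m<n. if B m then 1 else 0 :: ennreal)"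
    using n(2) by simp
  also have "\<dots> = (\<Sum>m. if B m then 1 else 0 :: ennreal)"
    by (rule suminf_finite[symmetric]) (use ge in \<open>auto simp: not_less\<close>)
  finally show ?thesis .
qed

text \<open>For \<open>\<rho> = 0\<close> both sides say \<open>x = 0\<close>, since
  \<open>x / 0\<close> is infinite for positive \<open>x\<close> and \<open>z\<close> is finite.
  Thus the convention for division by 0 agrees with the form without quotients.\<close>

lemma ennreal_divide_le_mult_iff:
  fixes x g \<rho> z :: ennreal
  assumes "0 < g" "g < \<infinity>" "\<rho> < \<infinity>" "z < \<infinity>"
  shows "x / (g * \<rho>) \<le> z \<longleftrightarrow> x \<le> z * \<rho> * g"
proof (cases "\<rho> = 0")
  case True
  have "x / 0 \<le> z \<longleftrightarrow> x = 0"
    using assms(4) by (cases "x = 0") (auto simp: ennreal_divide_zero top_unique)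
  then show ?thesis
    using True by simp
next
  case False
  have "x / b \<le> z \<longleftrightarrow> x \<le> z * b" if "b \<noteq> 0" "b < \<top>" for b
    using that
    by (cases x; cases b; cases z)
       (auto simp: divide_ennreal ennreal_mult[symmetric] field_simps ennreal_top_mult ennreal_top_divide top_unique)
  from this[of "g * \<rho>"] show ?thesis
    using assms False by (simp add: ennreal_mult_less_top mult_ac)
qed

section \<open>The essential supremum as an almost-everywhere inequality\<close>

definition max_ratio :: "('k \<Rightarrow> real) measure \<Rightarrow> (('k \<Rightarrow> real) \<Rightarrow> ennreal) \<Rightarrow> ennreal" where
  "max_ratio H g = esssup (density H g) (\<lambda>f. sup_fun f / g f)"

context
  fixes H :: "('k \<Rightarrow> real) measure" and g :: "('k \<Rightarrow> real) \<Rightarrow> ennreal"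
  assumes adm: "admissible H g"
    and sup_meas[measurable]: "sup_fun \<in> borel_measurable H"
begin

lemma density_measurable: "g \<in> borel_measurable H"
  using adm by (simp add: admissible_def)

lemma AE_admissible: "AE f in H. g f < \<infinity> \<and> (g f = 0 \<longrightarrow> sup_fun f = 0)"
proof -
  have "AE f in H. g f \<noteq> \<infinity>"
    using adm density_measurable by (intro nn_integral_PInf_AE) (auto simp: admissible_def)
  moreover have "AE f in H. \<not> (g f = 0 \<and> 0 < sup_fun f)"
    using adm by (auto simp: admissible_def intro!: AE_I'[of "{f\<in>space H. g f = 0 \<and> 0 < sup_fun f}"] simp: zero_less_iff_neq_zero)
  ultimately show ?thesis
    by eventually_elim (auto simp: less_top)
qed

text \<open>The density measure ignores the set where \<open>g\<close> vanishes, but there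
  \<open>sup_fun f = 0\<close> almost everywhere by admissibility, so the inequality can be stated
  under \<open>H\<close>. It separates \<open>\<rho>\<close> from the essential supremum: the
  stopping rule becomes \<open>max_ratio H g \<le> z * \<rho>\<close>.\<close>

lemma esssup_le_iff:
  assumes "\<rho> < \<infinity>" "z < \<infinity>"
  shows "esssup (density H g) (\<lambda>f. sup_fun f / (g f * \<rho>)) \<le> z \<longleftrightarrow> (AE f in H. sup_fun f \<le> z * \<rho> * g f)"
proof -
  note [measurable] = density_measurable
  let ?u = "\<lambda>f. sup_fun f / (g f * \<rho>)"
  have [measurable]: "?u \<in> borel_measurable (density H g)"
    by measurable
  have "esssup (density H g) ?u \<le> z \<longleftrightarrow> (AE f in density H g. ?u f \<le> z)"
  proof
    assume le: "esssup (density H g) ?u \<le> z"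
    show "AE f in density H g. ?u f \<le> z"
      by (rule eventually_mono[OF esssup_AE]) (rule order_trans[OF _ le])
  next
    assume "AE f in density H g. ?u f \<le> z"
    then show "esssup (density H g) ?u \<le> z"
      by (intro esssup_I) simp_all
  qed
  also have "\<dots> \<longleftrightarrow> (AE f in H. 0 < g f \<longrightarrow> ?u f \<le> z)"
    by (simp add: AE_density)
  also have "\<dots> \<longleftrightarrow> (AE f in H. sup_fun f \<le> z * \<rho> * g f)"
  proof -
    have "AE f in H. (0 < g f \<longrightarrow> ?u f \<le> z) \<longleftrightarrow> (sup_fun f \<le> z * \<rho> * g f)"
      using AE_admissible
    proof eventually_elim
      case (elim f)
      then show ?case
        using ennreal_divide_le_mult_iff[of "g f" \<rho> z "sup_fun f"] assms
        by (cases "g f = 0") (auto simp: zero_less_iff_neq_zero)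
    qed
    note eq = this
    show ?thesis
    proof
      assume "AE f in H. 0 < g f \<longrightarrow> ?u f \<le> z"
      with eq show "AE f in H. sup_fun f \<le> z * \<rho> * g f"
        by (rule eventually_elim2) blast
    next
      assume "AE f in H. sup_fun f \<le> z * \<rho> * g f"
      with eq show "AE f in H. 0 < g f \<longrightarrow> ?u f \<le> z"
        by (rule eventually_elim2) blast
    qed
  qed
  finally show ?thesis .
qed

lemma max_ratio_le_iff: "max_ratio H g \<le> z \<longleftrightarrow> (AE f in H. sup_fun f \<le> z * g f)"
proof (cases "z < \<infinity>")
  case True
  then show ?thesis
    using esssup_le_iff[of 1 z] by (simp add: max_ratio_def)
next
  case False
  then have z: "z = \<top>"
    by (simp add: not_less top_unique)
  \<comment> \<open>Since \<open>\<top> * 0 = 0\<close> in \<open>ennreal\<close>, infinite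
    \<open>z\<close> also requires \<open>sup_fun f = 0\<close> where
    \<open>g f = 0\<close>.\<close>
  have "AE f in H. sup_fun f \<le> \<top> * g f"
    using AE_admissible by eventually_elim (auto simp: ennreal_top_mult)
  then show ?thesis
    by (simp add: z)
qed

lemma sup_mass_le_max_ratio: "sup_mass H \<le> max_ratio H g"
proof -
  have "sup_mass H \<le> (\<integral>\<^sup>+ f. max_ratio H g * g f \<partial>H)"
    unfolding sup_mass_def using max_ratio_le_iff[of "max_ratio H g"] by (intro nn_integral_mono_AE) simp
  also have "\<dots> = max_ratio H g"
    using adm density_measurable by (simp add: nn_integral_cmult admissible_def)
  finally show ?thesis .
qed

end


text \<open>A common class for \<open>T\<close>, the supremum and every point evaluation, so that
  one formula serves all three stopping rules. Values are extended because \<open>sup_fun\<close>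
  may be infinite.\<close>

definition spectral_functional :: "(('k \<Rightarrow> real) \<Rightarrow> ennreal) \<Rightarrow> bool" where
  "spectral_functional R \<longleftrightarrow>
     (\<forall>a h. 0 < a \<longrightarrow> (\<forall>y. 0 \<le> h y) \<longrightarrow> R (\<lambda>y. a * h y) = ennreal a * R h) \<and>
     (\<forall>h1 h2. (\<forall>y. 0 \<le> h1 y) \<longrightarrow> (\<forall>y. 0 \<le> h2 y) \<longrightarrow> R (\<lambda>y. max (h1 y) (h2 y)) = max (R h1) (R h2)) \<and>
     R (\<lambda>_. 1) = 1"

lemma spectral_functional_scale:
  "spectral_functional R \<Longrightarrow> 0 < a \<Longrightarrow> (\<And>y. 0 \<le> h y) \<Longrightarrow> R (\<lambda>y. a * h y) = ennreal a * R h"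
  and spectral_functional_max:
  "spectral_functional R \<Longrightarrow> (\<And>y. 0 \<le> h1 y) \<Longrightarrow> (\<And>y. 0 \<le> h2 y) \<Longrightarrow>
    R (\<lambda>y. max (h1 y) (h2 y)) = max (R h1) (R h2)"
  and spectral_functional_one: "spectral_functional R \<Longrightarrow> R (\<lambda>_. 1) = 1"
  by (simp_all add: spectral_functional_def)

lemma spectral_functional_Max:
  assumes R: "spectral_functional R" and I: "finite I" "I \<noteq> {}"
    and "\<And>i. i \<in> I \<Longrightarrow> 0 < a i" "\<And>i y. i \<in> I \<Longrightarrow> 0 \<le> h i y"
  shows "R (\<lambda>y. MAX i\<in>I. a i * h i y) = (MAX i\<in>I. ennreal (a i) * R (h i))"
  using I assms(4,5)
proof (induction rule: finite_ne_induct)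
  case (singleton i)
  then show ?case by (simp add: spectral_functional_scale[OF R])
next
  case (insert i I)
  have "R (\<lambda>y. MAX i\<in>insert i I. a i * h i y) = R (\<lambda>y. max (a i * h i y) (MAX i\<in>I. a i * h i y))"
    using insert.hyps by simp
  also have "\<dots> = max (R (\<lambda>y. a i * h i y)) (R (\<lambda>y. MAX i\<in>I. a i * h i y))"
  proof (rule spectral_functional_max[OF R])
    show "0 \<le> a i * h i y" for y
      using insert.prems by (simp add: less_imp_le)
    obtain j where j: "j \<in> I" using insert.hyps by auto
    show "0 \<le> (MAX i\<in>I. a i * h i y)" for y
      using j insert.hyps insert.prems by (subst Max_ge_iff) (auto intro!: bexI[of _ j] mult_nonneg_nonneg simp: less_imp_le)
  qed
  finally show ?case
    using insert by (simp add: spectral_functional_scale[OF R])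
qed

lemma spectral_functional_mono:
  assumes R: "spectral_functional R" and "\<And>y. 0 \<le> h1 y" "\<And>y. h1 y \<le> h2 y"
  shows "R h1 \<le> R h2"
proof -
  have "h2 = (\<lambda>y. max (h1 y) (h2 y))"
    using assms by (auto simp: max_def intro: antisym)
  then have "R h2 = max (R h1) (R h2)"
    using spectral_functional_max[OF R, of h1 h2] assms by (metis order_trans)
  then show ?thesis by (metis max.cobounded1)
qed

lemma spectral_functional_const:
  "spectral_functional R \<Longrightarrow> 0 < a \<Longrightarrow> R (\<lambda>_. a) = ennreal a"
  using spectral_functional_scale[of R a "\<lambda>_. 1"] spectral_functional_one[of R] by simp

text \<open>Monotonicity compares \<open>h\<close> with a constant, on which homogeneity and
  normalization determine \<open>R\<close>. Homogeneity covers positive factors only and the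
  supremum \<open>s\<close> may be 0, hence the constant \<open>s + e\<close>.\<close>

lemma spectral_functional_le_sup:
  assumes R: "spectral_functional R" and h: "\<And>y. 0 \<le> h y"
  shows "R h \<le> sup_fun h"
proof (cases "sup_fun h")
  case top
  then show ?thesis by simp
next
  case (real s)
  have "h y \<le> s" for y
  proof -
    have "ennreal (h y) \<le> ennreal s"
      unfolding real(2)[symmetric] sup_fun_def by (rule SUP_upper) simp
    then show ?thesis using real(1) by simp
  qed
  show ?thesis
  proof (rule ennreal_le_epsilon)
    fix e :: real assume "0 < e"
    have "R h \<le> R (\<lambda>_. s + e)"
      by (rule spectral_functional_mono[OF R h]) (use \<open>\<And>y. h y \<le> s\<close> \<open>0 < e\<close> in \<open>simp add: add_increasing2 less_imp_le\<close>)
    also have "\<dots> = ennreal (s + e)"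
      using R real(1) \<open>0 < e\<close> by (intro spectral_functional_const) auto
    finally show "R h \<le> sup_fun h + ennreal e"
      using real \<open>0 < e\<close> by simp
  qed
qed

lemma spectral_functional_max_linear:
  assumes T: "max_linear T" and T1: "T (\<lambda>_. 1) = 1"
  shows "spectral_functional (\<lambda>h. ennreal (T h))"
proof -
  have nn: "0 \<le> T h" if "\<forall>y. 0 \<le> h y" for h
    using T that by (simp add: max_linear_def)
  have ml: "T (\<lambda>y. max (a1 * h1 y) (a2 * h2 y)) = max (a1 * T h1) (a2 * T h2)"
    if "0 < a1" "0 < a2" "\<forall>y. 0 \<le> h1 y" "\<forall>y. 0 \<le> h2 y" for a1 a2 h1 h2
    using T that unfolding max_linear_def by blast
  show ?thesis
    unfolding spectral_functional_def
  proof (intro conjI allI impI)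
    fix a :: real and h :: "'a \<Rightarrow> real" assume "0 < a" "\<forall>y. 0 \<le> h y"
    then show "ennreal (T (\<lambda>y. a * h y)) = ennreal a * ennreal (T h)"
      using ml[of a a h h] nn[of h] by (simp add: ennreal_mult)
  next
    fix h1 h2 :: "'a \<Rightarrow> real" assume "\<forall>y. 0 \<le> h1 y" "\<forall>y. 0 \<le> h2 y"
    then show "ennreal (T (\<lambda>y. max (h1 y) (h2 y))) = max (ennreal (T h1)) (ennreal (T h2))"
      using ml[of 1 1 h1 h2] nn[of h1] nn[of h2] by (simp add: max_def)
  qed (simp add: T1)
qed

lemma spectral_functional_sup_fun: "spectral_functional sup_fun"
  unfolding spectral_functional_def
proof (intro conjI allI impI)
  fix a :: real and h :: "'a \<Rightarrow> real" assume "0 < a" "\<forall>y. 0 \<le> h y"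
  then show "sup_fun (\<lambda>y. a * h y) = ennreal a * sup_fun h"
    by (simp add: sup_fun_def ennreal_mult SUP_mult_left_ennreal)
next
  fix h1 h2 :: "'a \<Rightarrow> real" assume "\<forall>y. 0 \<le> h1 y" "\<forall>y. 0 \<le> h2 y"
  have "sup_fun (\<lambda>y. max (h1 y) (h2 y)) = (SUP y. sup (ennreal (h1 y)) (ennreal (h2 y)))"
    unfolding sup_fun_def sup_max by (intro SUP_cong refl) (auto simp: max_def intro!: antisym ennreal_leI)
  also have "\<dots> = sup (sup_fun h1) (sup_fun h2)"
    unfolding sup_fun_def by (rule complete_lattice_class.SUP_sup_distrib[symmetric])
  finally show "sup_fun (\<lambda>y. max (h1 y) (h2 y)) = max (sup_fun h1) (sup_fun h2)"
    unfolding sup_max .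
qed (simp add: sup_fun_def)

lemma spectral_functional_eval: "spectral_functional (\<lambda>h. ennreal (h y))"
  by (auto simp: spectral_functional_def ennreal_mult max_def)

section \<open>The expected stopping number\<close>

text \<open>Stopping would bound \<open>max_ratio H g\<close> by a product of two finite numbers.
  The lemma serves both infinite \<open>c\<close>, where finiteness holds because \<open>T\<close>
  is real-valued, and densities of infinite ratio when \<open>c\<close> is finite.\<close>

lemma expected_number_infinite:
  assumes adm: "admissible H g" and sup_meas: "sup_fun \<in> borel_measurable H"
    and P: "prob_space P" and unbounded: "max_ratio H g = \<infinity>"
    and fin: "AE \<omega> in P. \<forall>m\<ge>1. R (partial_max g E F m \<omega>) < \<infinity>"
  shows "expected_number H R g P E F = \<infinity>"
proof -
  interpret prob_space P by fact
  have "AE \<omega> in P. stopping_number H R g E F \<omega> = \<infinity>"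
    using fin
  proof eventually_elim
    case (elim \<omega>)
    have "{m::nat. 1 \<le> m \<and> esssup (density H g) (\<lambda>f. sup_fun f / (g f * R (partial_max g E F m \<omega>)))
            \<le> ennreal (\<Sum>j\<le>m. E j \<omega>)} = {}"
    proof (intro equals0I, clarify)
      fix m :: nat assume m: "1 \<le> m"
        and le: "esssup (density H g) (\<lambda>f. sup_fun f / (g f * R (partial_max g E F m \<omega>))) \<le> ennreal (\<Sum>j\<le>m. E j \<omega>)"
      have fin: "R (partial_max g E F m \<omega>) < \<infinity>"
        using elim m by blast
      from le have "max_ratio H g \<le> ennreal (\<Sum>j\<le>m. E j \<omega>) * R (partial_max g E F m \<omega>)"
        by (subst (asm) esssup_le_iff[OF adm sup_meas fin]) (simp_all add: max_ratio_le_iff[OF adm sup_meas])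
      moreover have "\<dots> < \<infinity>"
        using fin by (simp add: ennreal_mult_less_top)
      ultimately show False
        using unbounded by (simp add: top_unique)
    qed
    then show ?case
      unfolding stopping_number_def by simp
  qed
  then have "expected_number H R g P E F = (\<integral>\<^sup>+ \<omega>. \<infinity> \<partial>P)"
    unfolding expected_number_def by (rule nn_integral_cong_AE)
  then show ?thesis
    by (simp add: emeasure_space_1)
qed

section \<open>The expected number for a fixed density and finite \<open>c\<close>\<close>

locale spectral_simulation =
  fixes H :: "('k \<Rightarrow> real) measure" and g R :: "('k \<Rightarrow> real) \<Rightarrow> ennreal"
    and P :: "'w measure" and E :: "nat \<Rightarrow> 'w \<Rightarrow> real" and F :: "nat \<Rightarrow> 'w \<Rightarrow> 'k \<Rightarrow> real"
  assumes adm: "admissible H g"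
    and sup_meas[measurable]: "sup_fun \<in> borel_measurable H"
    and nonneg: "f \<in> space H \<Longrightarrow> 0 \<le> f y"
    and sim: "simulation_input H g P E F"
    and R: "spectral_functional R"
    and R_meas[measurable]: "R \<in> borel_measurable H"
    and sup_mass_finite: "sup_mass H < \<infinity>"
begin

sublocale prob_space P
  using sim unfolding simulation_input_def by (rule conjunct1)

lemma g_meas[measurable]: "g \<in> borel_measurable H"
  using adm by (simp add: admissible_def)

lemma E_distributed: "distributed P lborel (E j) (exponential_density 1)"
  and F_distributed: "distributed P H (F i) g"
  using sim[unfolded simulation_input_def, THEN conjunct2]
  by (rule spec[OF conjunct1], rule spec[OF conjunct1[OF conjunct2]])

lemma F_meas[measurable]: "F i \<in> P \<rightarrow>\<^sub>M H"
  and F_distr: "distr P H (F i) = density H g"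
  using F_distributed by (simp_all only: distributed_def)

lemma E_meas[measurable]: "E j \<in> borel_measurable P"
  using distributed_measurable[OF E_distributed[of j]] by simp

lemma AE_E_pos: "AE \<omega> in P. 0 < E j \<omega>"
proof -
  have "AE x in lborel. 0 < ennreal (exponential_density 1 x) \<longrightarrow> (0::real) < x"
    by (rule AE_mp[OF AE_lborel_singleton[of 0]]) (auto intro!: AE_I2 simp: exponential_density_def)
  then have "AE x in distr P lborel (E j). 0 < x"
    unfolding distributed_distr_eq_density[OF E_distributed] by (subst AE_density) simp_all
  then show ?thesis
    by (rule AE_distrD[rotated]) simp
qed

text \<open>What holds almost surely for a sampled function, collected so that the stopping rule can
  be analysed on a fixed path without exceptional sets.\<close>

definition regular :: "('k \<Rightarrow> real) \<Rightarrow> bool" where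
  "regular f \<longleftrightarrow> (\<forall>y. 0 \<le> f y) \<and> 0 < g f \<and> g f < \<infinity> \<and> sup_fun f < \<infinity> \<and> R f \<le> sup_fun f
     \<and> sup_fun f \<le> max_ratio H g * g f"

text \<open>Stated under \<open>H\<close> and not only under the sampling law: \<open>R\<close>
  vanishes where \<open>g\<close> does, so no mass of \<open>R\<close> is lost when its integral is
  rewritten as the mean mark.\<close>

lemma AE_regular: "AE f in H. g f = 0 \<and> R f = 0 \<or> regular f"
proof -
  have "AE f in H. sup_fun f \<noteq> \<infinity>"
    using sup_mass_finite by (intro nn_integral_PInf_AE) (auto simp: sup_mass_def)
  moreover have "AE f in H. sup_fun f \<le> max_ratio H g * g f"
    using max_ratio_le_iff[OF adm sup_meas] by blast
  moreover note AE_admissible[OF adm sup_meas] AE_space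
  ultimately show ?thesis
  proof eventually_elim
    case (elim f)
    have "R f \<le> sup_fun f"
      by (rule spectral_functional_le_sup[OF R]) (rule nonneg, fact)
    with elim nonneg show ?case
      unfolding regular_def by (cases "g f = 0") (auto simp: zero_less_iff_neq_zero less_top)
  qed
qed

lemma AE_density_regular: "AE f in density H g. regular f"
proof -
  have "AE f in H. 0 < g f \<longrightarrow> regular f"
    using AE_regular by eventually_elim auto
  then show ?thesis
    by (simp add: AE_density)
qed

lemma AE_input: "AE \<omega> in P. (\<forall>j. 0 < E j \<omega>) \<and> (\<forall>i. regular (F i \<omega>))"
proof -
  have "AE \<omega> in P. regular (F i \<omega>)" for i
    using AE_density_regular unfolding F_distr[of i, symmetric] by (rule AE_distrD[rotated]) simp
  then show ?thesis
    using AE_E_pos by (auto simp: AE_all_countable)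
qed

lemma R_partial_max:
  assumes E: "\<And>j. 0 < E j \<omega>" and F: "\<And>i. regular (F i \<omega>)" and "1 \<le> m"
  shows "R (partial_max g E F m \<omega>) = (MAX i\<in>{..<m}. ennreal (enn2real (R (F i \<omega>) / g (F i \<omega>)) / (\<Sum>j\<le>i. E j \<omega>)))"
proof -
  have S: "0 < (\<Sum>j\<le>i. E j \<omega>)" for i
    using E by (intro sum_pos) auto
  have g: "0 < enn2real (g (F i \<omega>))" for i
    using F[of i] by (simp add: regular_def enn2real_positive_iff)
  have "{..<m} \<noteq> {}"
    using \<open>1 \<le> m\<close> by (auto simp: lessThan_empty_iff)
  have "R (partial_max g E F m \<omega>) = R (\<lambda>y. MAX i\<in>{..<m}. (1 / (\<Sum>j\<le>i. E j \<omega>) / enn2real (g (F i \<omega>))) * F i \<omega> y)"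
    unfolding partial_max_def[abs_def] by simp
  also have "\<dots> = (MAX i\<in>{..<m}. ennreal (1 / (\<Sum>j\<le>i. E j \<omega>) / enn2real (g (F i \<omega>))) * R (F i \<omega>))"
    using S g F \<open>{..<m} \<noteq> {}\<close> by (intro spectral_functional_Max[OF R]) (auto simp: regular_def)
  also have "(\<lambda>i. ennreal (1 / (\<Sum>j\<le>i. E j \<omega>) / enn2real (g (F i \<omega>))) * R (F i \<omega>))
    = (\<lambda>i. ennreal (enn2real (R (F i \<omega>) / g (F i \<omega>)) / (\<Sum>j\<le>i. E j \<omega>)))"
  proof
    fix i
    have "R (F i \<omega>) < \<infinity>"
      using F[of i] by (auto simp: regular_def intro: le_less_trans)
    then obtain a b where "0 \<le> a" "R (F i \<omega>) = ennreal a" "0 < b" "g (F i \<omega>) = ennreal b"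
      using F[of i] by (cases "R (F i \<omega>)"; cases "g (F i \<omega>)") (auto simp: regular_def)
    then show "ennreal (1 / (\<Sum>j\<le>i. E j \<omega>) / enn2real (g (F i \<omega>))) * R (F i \<omega>)
      = ennreal (enn2real (R (F i \<omega>) / g (F i \<omega>)) / (\<Sum>j\<le>i. E j \<omega>))"
      using S[of i] by (simp add: divide_ennreal ennreal_mult[symmetric] less_imp_le field_simps)
  qed
  finally show ?thesis .
qed

definition mark_of :: "('k \<Rightarrow> real) \<Rightarrow> real" where
  "mark_of f = enn2real (R f / g f) / enn2real (max_ratio H g)"

lemma mark_of_meas[measurable]: "mark_of \<in> borel_measurable H"
  unfolding mark_of_def by measurable

definition inputs :: "nat + nat \<Rightarrow> 'w \<Rightarrow> real" where
  "inputs = case_sum E (\<lambda>i \<omega>. mark_of (F i \<omega>))"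

text \<open>A finite maximum reaches a bound iff one entry does, which leaves finitely many scalar
  comparisons. The series form allows the expectation to be taken term by term.\<close>

lemma stopping_number_eq:
  assumes E: "\<And>j. 0 < E j \<omega>" and F: "\<And>i. regular (F i \<omega>)"
    and C: "0 < max_ratio H g" "max_ratio H g < \<infinity>"
  shows "stopping_number H R g E F \<omega>
    = (\<Sum>m. late_arrivals m (\<lambda>i. inputs i \<omega>) (arrival_time (Suc m) (\<lambda>i. inputs i \<omega>)))"
proof -
  let ?S = "\<lambda>m. \<Sum>j\<le>m. E j \<omega>"
  let ?\<rho> = "\<lambda>i. enn2real (R (F i \<omega>) / g (F i \<omega>))"
  define c where "c = enn2real (max_ratio H g)"
  have c: "0 < c" "max_ratio H g = ennreal c"
    using C by (auto simp: c_def enn2real_positive_iff)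
  have S: "0 < ?S i" for i
    using E by (intro sum_pos) auto
  \<comment> \<open>\<open>?S m\<close> adds \<open>m + 1\<close> waiting times. So
    \<open>?S i\<close> is the arrival time of the point with index \<open>i\<close>, and
    \<open>?S m\<close> that of the first point outside the partial maximum.\<close>
  define B where "B = (\<lambda>m. \<forall>i<m. mark_of (F i \<omega>) * ?S m < ?S i)"
  have stop: "esssup (density H g) (\<lambda>f. sup_fun f / (g f * R (partial_max g E F m \<omega>))) \<le> ennreal (?S m) \<longleftrightarrow> \<not> B m"
    if "1 \<le> m" for m
  proof -
    have ne: "{..<m} \<noteq> {}"
      using that by (auto simp: lessThan_empty_iff)
    let ?M = "MAX i\<in>{..<m}. ennreal (?\<rho> i / ?S i)"
    have R: "R (partial_max g E F m \<omega>) = ?M"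
      by (rule R_partial_max[OF E F that])
    have "?M \<in> (\<lambda>i. ennreal (?\<rho> i / ?S i)) ` {..<m}"
      using ne by (intro Max_in) auto
    then obtain k where k: "k < m" "?M = ennreal (?\<rho> k / ?S k)"
      by auto
    then have fin: "R (partial_max g E F m \<omega>) < \<infinity>"
      by (simp add: R)
    have "esssup (density H g) (\<lambda>f. sup_fun f / (g f * R (partial_max g E F m \<omega>))) \<le> ennreal (?S m)
      \<longleftrightarrow> ennreal c \<le> ennreal (?S m) * ?M"
      by (subst esssup_le_iff[OF adm sup_meas fin])
         (simp_all add: max_ratio_le_iff[OF adm sup_meas, symmetric] R c)
    also have "\<dots> \<longleftrightarrow> (\<exists>i<m. ennreal c \<le> ennreal (?S m) * ennreal (?\<rho> i / ?S i))"
    proof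
      assume "ennreal c \<le> ennreal (?S m) * ?M"
      then show "\<exists>i<m. ennreal c \<le> ennreal (?S m) * ennreal (?\<rho> i / ?S i)"
        using k by metis
    next
      assume "\<exists>i<m. ennreal c \<le> ennreal (?S m) * ennreal (?\<rho> i / ?S i)"
      then obtain i where i: "i < m" "ennreal c \<le> ennreal (?S m) * ennreal (?\<rho> i / ?S i)"
        by blast
      have "ennreal (?\<rho> i / ?S i) \<le> ?M"
        using i by (intro Max_ge) auto
      with i(2) show "ennreal c \<le> ennreal (?S m) * ?M"
        by (meson mult_left_mono order_trans zero_le)
    qed
    also have "\<dots> \<longleftrightarrow> \<not> B m"
    proof -
      have "ennreal c \<le> ennreal (?S m) * ennreal (?\<rho> i / ?S i) \<longleftrightarrow> \<not> mark_of (F i \<omega>) * ?S m < ?S i" for i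
      proof -
        have "ennreal c \<le> ennreal (?S m) * ennreal (?\<rho> i / ?S i) \<longleftrightarrow> c \<le> ?S m * (?\<rho> i / ?S i)"
          using c S[of m] S[of i] by (simp add: ennreal_mult[symmetric] less_imp_le)
        also have "\<dots> \<longleftrightarrow> ?S i \<le> mark_of (F i \<omega>) * ?S m"
          using c S[of i] by (simp add: mark_of_def c_def[symmetric] field_simps)
        finally show ?thesis by (simp add: not_less)
      qed
      then show ?thesis unfolding B_def by simp
    qed
    finally show ?thesis .
  qed
  have "stopping_number H R g E F \<omega> = (INF m\<in>{m. 1 \<le> m \<and> \<not> B m}. of_nat m)"
    unfolding stopping_number_def using stop by (intro INF_cong Collect_cong) auto
  also have "\<dots> = (\<Sum>m. if B m then 1 else 0)"
  proof (rule INF_first_failure_eq_suminf)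
    show "B 0" by (simp add: B_def)
    fix m assume "B (Suc m)"
    moreover have "mark_of (F i \<omega>) * ?S m \<le> mark_of (F i \<omega>) * ?S (Suc m)" for i
      using E[of "Suc m"] c(1) by (intro mult_left_mono) (auto simp: mark_of_def)
    ultimately show "B m"
      unfolding B_def by (meson le_less_trans less_SucI)
  qed
  also have "\<dots> = (\<Sum>m. late_arrivals m (\<lambda>i. inputs i \<omega>) (arrival_time (Suc m) (\<lambda>i. inputs i \<omega>)))"
    by (simp add: late_arrivals_eq B_def arrival_time_def inputs_def lessThan_Suc_atMost)
  finally show ?thesis .
qed

text \<open>Marks are measurable functions of the sampled functions, so their preimages form
  subfamilies of the independent ones. The bound 1 comes from
  \<open>R f \<le> sup_fun f \<le> max_ratio H g * g f\<close>.\<close>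

lemma marked_arrivals_inputs:
  assumes C: "0 < max_ratio H g" "max_ratio H g < \<infinity>"
  shows "marked_arrivals P inputs (distr (density H g) borel mark_of)"
proof
  have "indep_sets (case_sum (\<lambda>j. {E j -` A \<inter> space P | A. A \<in> sets borel})
                 (\<lambda>i. {F i -` A \<inter> space P | A. A \<in> sets H})) UNIV"
    using sim by (simp add: simulation_input_def)
  then have "indep_sets (\<lambda>k. {inputs k -` A \<inter> space P | A. A \<in> sets borel}) UNIV"
  proof (rule indep_sets_mono_sets)
    fix k :: "nat + nat"
    show "{inputs k -` A \<inter> space P | A. A \<in> sets borel} \<subseteq>
      case_sum (\<lambda>j. {E j -` A \<inter> space P | A. A \<in> sets borel}) (\<lambda>i. {F i -` A \<inter> space P | A. A \<in> sets H}) k"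
    proof (cases k)
      case (Inl j)
      then show ?thesis by (auto simp: inputs_def)
    next
      case (Inr i)
      have "inputs k -` A \<inter> space P = F i -` (mark_of -` A \<inter> space H) \<inter> space P" for A
        using measurable_space[OF F_meas[of i]] by (auto simp: inputs_def Inr)
      moreover have "mark_of -` A \<inter> space H \<in> sets H" if "A \<in> sets borel" for A
        using that by measurable
      ultimately have "\<exists>A'\<in>sets H. inputs k -` A \<inter> space P = F i -` A' \<inter> space P" if "A \<in> sets borel" for A
        using that Inr by metis
      note ex = this
      show ?thesis
      proof
        fix B assume "B \<in> {inputs k -` A \<inter> space P | A. A \<in> sets borel}"
        then obtain A where "A \<in> sets borel" "B = inputs k -` A \<inter> space P"
          by blast
        with ex[of A] show "B \<in> case_sum (\<lambda>j. {E j -` A \<inter> space P | A. A \<in> sets borel})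
            (\<lambda>i. {F i -` A \<inter> space P | A. A \<in> sets H}) k"
          unfolding Inr sum.case by blast
      qed
    qed
  qed
  moreover have "inputs k \<in> borel_measurable P" for k
    by (cases k) (simp_all add: inputs_def)
  ultimately show "indep_vars (\<lambda>_. borel) inputs UNIV"
    by (simp add: indep_vars_def2)
  show "distributed P lborel (inputs (Inl j)) (exponential_density 1)" for j
    using E_distributed by (simp add: inputs_def)
  show "distr P borel (inputs (Inr i)) = distr (density H g) borel mark_of" for i
    unfolding F_distr[of i, symmetric] by (subst distr_distr) (simp_all add: inputs_def comp_def)
  have "AE f in density H g. 0 \<le> mark_of f \<and> mark_of f \<le> 1"
    using AE_density_regular
  proof eventually_elim
    case (elim f)
    then have g: "0 < g f" "g f < \<infinity>" and "R f \<le> max_ratio H g * g f"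
      by (auto simp: regular_def)
    have "R f / g f \<le> max_ratio H g"
      using g \<open>R f \<le> max_ratio H g * g f\<close> C ennreal_divide_le_mult_iff[of "g f" 1 "max_ratio H g" "R f"] by simp
    then have "enn2real (R f / g f) \<le> enn2real (max_ratio H g)"
      using C by (intro enn2real_mono) auto
    then show ?case
      using C by (simp add: mark_of_def enn2real_positive_iff divide_le_eq_1)
  qed
  then show "AE y in distr (density H g) borel mark_of. 0 \<le> y \<and> y \<le> 1"
    by (subst AE_distr_iff) simp_all
qed

text \<open>Under the sampling law the density cancels: the mean mark is the integral of
  \<open>R\<close> under \<open>H\<close> divided by \<open>max_ratio H g\<close>. Its positivity
  gives \<open>q < 1\<close>, so the geometric series converges.\<close>

theorem expected_number_eq:
  assumes pos: "0 < (\<integral>\<^sup>+ f. R f \<partial>H)"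
  shows "expected_number H R g P E F = max_ratio H g / (\<integral>\<^sup>+ f. R f \<partial>H)"
proof -
  define p where "p = (\<integral>\<^sup>+ f. R f \<partial>H)"
  have "p \<le> sup_mass H"
    unfolding p_def sup_mass_def
    by (intro nn_integral_mono spectral_functional_le_sup[OF R] nonneg)
  then have "p < \<infinity>" "p \<le> max_ratio H g"
    using sup_mass_finite sup_mass_le_max_ratio[OF adm sup_meas] by auto
  then obtain p0 where p0: "0 < p0" "p = ennreal p0"
    using pos by (cases p) (auto simp: p_def[symmetric])
  show ?thesis
  proof (cases "max_ratio H g < \<infinity>")
    case False
    have "AE \<omega> in P. \<forall>m\<ge>1. R (partial_max g E F m \<omega>) < \<infinity>"
      using AE_input
    proof (eventually_elim, intro allI impI)
      fix \<omega> m assume \<omega>: "(\<forall>j. 0 < E j \<omega>) \<and> (\<forall>i. regular (F i \<omega>))" and m: "(1::nat) \<le> m"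
      then have "{..<m} \<noteq> {}"
        by (auto simp: lessThan_empty_iff)
      then show "R (partial_max g E F m \<omega>) < \<infinity>"
        using \<omega> m by (subst R_partial_max) auto
    qed
    then have "expected_number H R g P E F = \<infinity>"
      using False by (intro expected_number_infinite[OF adm sup_meas]) (auto simp: not_less top_unique prob_space_axioms)
    then show ?thesis
      using False p0 by (simp add: not_less top_unique p_def[symmetric] ennreal_top_divide)
  next
    case True
    then obtain c where c: "max_ratio H g = ennreal c" "0 < c"
      using \<open>p \<le> max_ratio H g\<close> p0 by (cases "max_ratio H g") (auto simp: ennreal_le_iff2 dest: order.strict_trans2)
    interpret marked_arrivals P inputs "distr (density H g) borel mark_of"
      using c by (intro marked_arrivals_inputs) auto
    \<comment> \<open>The mean mark is related to \<open>q\<close> by a sum equal to 1, which avoids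
      truncated subtraction in \<open>ennreal\<close>.\<close>
    have "AE f in density H g. ennreal (1 - mark_of f) + ennreal (mark_of f) = 1"
    proof -
      have "AE f in density H g. 0 \<le> mark_of f \<and> mark_of f \<le> 1"
        using mark_bounds by (rule AE_distrD[rotated]) simp
      then show ?thesis
        by eventually_elim (simp add: ennreal_plus[symmetric] del: ennreal_plus)
    qed
    then have "(\<integral>\<^sup>+ f. ennreal (1 - mark_of f) + ennreal (mark_of f) \<partial>density H g) = (\<integral>\<^sup>+ f. 1 \<partial>density H g)"
      by (rule nn_integral_cong_AE)
    also have "\<dots> = 1"
      using adm by (simp add: emeasure_density admissible_def cong: nn_integral_cong)
    also have "(\<integral>\<^sup>+ f. ennreal (1 - mark_of f) + ennreal (mark_of f) \<partial>density H g)
      = q + (\<integral>\<^sup>+ f. ennreal (mark_of f) \<partial>density H g)"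
      unfolding q_def by (subst nn_integral_add) (simp_all add: nn_integral_distr)
    also have "(\<integral>\<^sup>+ f. ennreal (mark_of f) \<partial>density H g) = (\<integral>\<^sup>+ f. g f * ennreal (mark_of f) \<partial>H)"
      by (simp add: nn_integral_density)
    also have "\<dots> = (\<integral>\<^sup>+ f. R f * ennreal (1 / c) \<partial>H)"
    proof (rule nn_integral_cong_AE)
      show "AE f in H. g f * ennreal (mark_of f) = R f * ennreal (1 / c)"
        using AE_regular
      proof eventually_elim
        case (elim f)
        then show ?case
        proof
          assume f: "regular f"
          have "R f < \<infinity>"
            using f by (auto simp: regular_def intro: le_less_trans)
          then obtain a b where "0 \<le> a" "R f = ennreal a" "0 < b" "g f = ennreal b"
            using f by (cases "R f"; cases "g f") (auto simp: regular_def)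
          then show ?thesis
            using c by (simp add: mark_of_def divide_ennreal ennreal_mult[symmetric])
        qed auto
      qed
    qed
    also have "\<dots> = p * ennreal (1 / c)"
      unfolding p_def by (rule nn_integral_multc) simp
    also have "\<dots> = ennreal (p0 / c)"
      using p0 c by (simp add: ennreal_mult[symmetric])
    finally have q: "q + ennreal (p0 / c) = 1" .
    then obtain t where t: "0 \<le> t" "q = ennreal t"
      by (cases q) auto
    with q p0 c have "ennreal (t + p0 / c) = ennreal 1"
      by simp
    then have "t + p0 / c = 1"
      using t p0 c by (subst (asm) ennreal_inj) auto
    then have t1: "t = 1 - p0 / c"
      by simp
    moreover have "0 < p0 / c"
      using p0 c by simp
    ultimately have "t < 1"
      by linarith
    have "expected_number H R g P E F = (\<integral>\<^sup>+ \<omega>. (\<Sum>m. late_arrivals m (V \<omega>) (arrival_time (Suc m) (V \<omega>))) \<partial>P)"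
      unfolding expected_number_def
      by (rule nn_integral_cong_AE, rule eventually_mono[OF AE_input]) (use c in \<open>auto intro!: stopping_number_eq\<close>)
    also have "\<dots> = (\<Sum>m. q ^ m)"
      by (subst nn_integral_suminf) (simp_all add: expected_late_arrivals)
    also have "\<dots> = (\<Sum>m. ennreal (t ^ m))"
      using t by (simp add: ennreal_power)
    also have "\<dots> = ennreal (\<Sum>m. t ^ m)"
      using t \<open>t < 1\<close> by (intro suminf_ennreal2) (auto intro: summable_geometric)
    also have "(\<Sum>m. t ^ m) = 1 / (1 - t)"
      using t \<open>t < 1\<close> by (intro suminf_geometric) simp
    also have "\<dots> = c / p0"
      by (simp add: t1)
    finally show ?thesis
      using c p0 by (simp add: p_def[symmetric] divide_ennreal)
  qed
qed

end

section \<open>Positivity of the Poisson maximum\<close>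

text \<open>Markov's inequality bounds the mass of functions with supremum at least
  \<open>1 / n\<close>. Only the zero function has supremum 0, and there local finiteness applies.
  The result justifies Fubini for the product intensity.\<close>

lemma sigma_finite_spectral_measure:
  assumes nonneg: "\<And>f y. f \<in> topspace X \<Longrightarrow> 0 \<le> f y"
    and borel: "borel_measure_on X H" and lf: "locally_finite_on X H"
    and sup_meas[measurable]: "sup_fun \<in> borel_measurable H" and fin: "sup_mass H < \<infinity>"
  shows "sigma_finite_measure H"
proof -
  define A where "A = (\<lambda>n. {f \<in> space H. 1 \<le> of_nat n * sup_fun f})"
  define Z where "Z = {f \<in> space H. sup_fun f = 0}"
  have [measurable]: "A n \<in> sets H" "Z \<in> sets H" for n
    unfolding A_def Z_def by measurable
  have "emeasure H (A n) \<noteq> \<infinity>" for n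
  proof -
    have "emeasure H (A n) \<le> of_nat n * (\<integral>\<^sup>+ f. sup_fun f * indicator (space H) f \<partial>H)"
      using nn_integral_Markov_inequality[of sup_fun "space H" H "of_nat n"]
      by (simp add: A_def)
    also have "\<dots> = of_nat n * sup_mass H"
      by (simp add: sup_mass_def cong: nn_integral_cong)
    also have "\<dots> < \<infinity>"
      using fin by (simp add: ennreal_mult_less_top of_nat_less_top)
    finally show ?thesis by simp
  qed
  moreover have "emeasure H Z \<noteq> \<infinity>"
  proof (cases "Z = {}")
    case False
    have zero: "f = (\<lambda>_. 0)" if "f \<in> Z" for f
    proof
      fix y
      have "ennreal (f y) \<le> sup_fun f"
        unfolding sup_fun_def by (rule SUP_upper) simp
      then show "f y = 0"
        using that nonneg[of f y] borel by (auto simp: Z_def borel_measure_on_def)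
    qed
    with False have "(\<lambda>_. 0) \<in> topspace X"
      using borel by (auto simp: Z_def borel_measure_on_def)
    then obtain U where U: "openin X U" "(\<lambda>_. 0) \<in> U" "emeasure H U < \<infinity>"
      using lf unfolding locally_finite_on_def by blast
    then have "U \<in> sets H"
      using borel by (auto simp: borel_measure_on_def)
    moreover have "Z \<subseteq> U"
      using zero U(2) by auto
    ultimately show ?thesis
      using U(3) emeasure_mono[of Z U H] by auto
  qed simp
  moreover have "space H \<subseteq> \<Union> (insert Z (range A))"
  proof
    fix f assume f: "f \<in> space H"
    show "f \<in> \<Union> (insert Z (range A))"
    proof (cases "sup_fun f = 0")
      case False
      have "\<exists>n. 1 \<le> of_nat n * sup_fun f"
      proof (cases "sup_fun f")
        case (real r)
        then obtain n where "1 < of_nat n * r"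
          using False ex_less_of_nat_mult[of r 1] by auto
        then have "1 \<le> of_nat n * sup_fun f"
          using real by (simp add: ennreal_of_nat_eq_real_of_nat ennreal_mult[symmetric])
        then show ?thesis ..
      next
        case top
        then show ?thesis by (intro exI[of _ 1]) simp
      qed
      then show ?thesis using f by (auto simp: A_def)
    qed (use f in \<open>simp add: Z_def\<close>)
  qed
  moreover have "Z \<in> sets H" "A n \<in> sets H" for n
    by measurable
  ultimately show ?thesis
    by (intro sigma_finite_measure.intro exI[of _ "insert Z (range A)"])
       (auto simp: A_def Z_def)
qed

lemma nn_integral_inverse_square:
  assumes "0 < a"
  shows "(\<integral>\<^sup>+ t. ennreal (1 / t\<^sup>2) * indicator {a..} t \<partial>lborel) = ennreal (1 / a)"
proof -
  have "(\<integral>\<^sup>+ t. ennreal (1 / t\<^sup>2) * indicator {a..} t \<partial>lborel) = ennreal (0 - (- 1 / a))"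
  proof (rule nn_integral_FTC_atLeast)
    show "((\<lambda>t. - 1 / t) \<longlongrightarrow> (0::real)) at_top"
      by real_asymp
    show "((\<lambda>t. - 1 / t) has_real_derivative 1 / t\<^sup>2) (at t)" if "a \<le> t" for t
      using that assms by (auto intro!: derivative_eq_intros simp: power2_eq_square)
  qed auto
  then show ?thesis by simp
qed

lemma nn_integral_frechet_intensity:
  assumes [measurable]: "u \<in> borel_measurable borel"
  shows "(\<integral>\<^sup>+ t. u t \<partial>density (restrict_space lborel {0<..}) (\<lambda>t. ennreal (1 / t\<^sup>2)))
       = (\<integral>\<^sup>+ t. ennreal (1 / t\<^sup>2) * u t * indicator {0<..} t \<partial>lborel)"
proof -
  have "u \<in> borel_measurable (restrict_space lborel {0<..})"
    "(\<lambda>t. ennreal (1 / t\<^sup>2)) \<in> borel_measurable (restrict_space lborel {0<..})"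
    by (rule measurable_restrict_space1, simp)+
  then show ?thesis
    by (simp add: nn_integral_density nn_integral_restrict_space)
qed

lemma space_spectral_intensity: "space (spectral_intensity H) = {0<..} \<times> space H"
  by (simp add: spectral_intensity_def space_pair_measure space_restrict_space)

lemma sets_spectral_intensity:
  "sets (spectral_intensity H) = sets (restrict_space borel {0<..} \<Otimes>\<^sub>M H)"
  unfolding spectral_intensity_def
  by (intro sets_pair_measure_cong) (auto simp: sets_restrict_space)

lemma emeasure_spectral_intensity:
  assumes H: "sigma_finite_measure H" and Q[measurable]: "Measurable.pred (borel \<Otimes>\<^sub>M H) Q"
  shows "{p \<in> {0<..} \<times> space H. Q p} \<in> sets (spectral_intensity H)"
    and "emeasure (spectral_intensity H) {p \<in> {0<..} \<times> space H. Q p}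
       = (\<integral>\<^sup>+ f. (\<integral>\<^sup>+ t. (if 0 < t \<and> Q (t, f) then ennreal (1 / t\<^sup>2) else 0) \<partial>lborel) \<partial>H)"
proof -
  interpret H: sigma_finite_measure H by fact
  interpret pair_sigma_finite lborel H ..
  let ?A = "{p \<in> {0<..} \<times> space H. Q p}"
  have [measurable]: "Measurable.pred (restrict_space borel {0<..} \<Otimes>\<^sub>M H) Q"
  proof -
    have "(\<lambda>p. (fst p, snd p)) \<in> restrict_space borel {0<..} \<Otimes>\<^sub>M H \<rightarrow>\<^sub>M borel \<Otimes>\<^sub>M H"
      by (intro measurable_Pair measurable_snd measurable_compose[OF measurable_fst measurable_restrict_space1]) simp_all
    from measurable_compose[OF this Q] show ?thesis by simp
  qed
  have "{p \<in> space (restrict_space borel {0<..} \<Otimes>\<^sub>M H). Q p} \<in> sets (restrict_space borel {0<..} \<Otimes>\<^sub>M H)"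
    by measurable
  then show A: "?A \<in> sets (spectral_intensity H)"
    by (simp add: sets_spectral_intensity space_pair_measure space_restrict_space)
  have [measurable]: "Measurable.pred (lborel \<Otimes>\<^sub>M H) Q"
    using Q by (simp cong: measurable_cong_sets)
  have "emeasure (spectral_intensity H) ?A = (\<integral>\<^sup>+ t. (\<integral>\<^sup>+ f. indicator ?A (t, f) \<partial>H)
      \<partial>density (restrict_space lborel {0<..}) (\<lambda>t. ennreal (1 / t\<^sup>2)))"
    using A unfolding spectral_intensity_def by (rule H.emeasure_pair_measure)
  also have "\<dots> = (\<integral>\<^sup>+ t. (\<integral>\<^sup>+ f. (if Q (t, f) then 1 else 0) \<partial>H)
      \<partial>density (restrict_space lborel {0<..}) (\<lambda>t. ennreal (1 / t\<^sup>2)))"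
    by (intro nn_integral_cong) (auto simp: space_restrict_space indicator_def)
  also have "\<dots> = (\<integral>\<^sup>+ t. ennreal (1 / t\<^sup>2) * (\<integral>\<^sup>+ f. (if Q (t, f) then 1 else 0) \<partial>H) * indicator {0<..} t \<partial>lborel)"
    by (rule nn_integral_frechet_intensity) measurable
  also have "\<dots> = (\<integral>\<^sup>+ t. (\<integral>\<^sup>+ f. (if 0 < t \<and> Q (t, f) then ennreal (1 / t\<^sup>2) else 0) \<partial>H) \<partial>lborel)"
  proof (intro nn_integral_cong)
    fix t :: real
    have "ennreal (1 / t\<^sup>2) * (\<integral>\<^sup>+ f. (if Q (t, f) then 1 else 0) \<partial>H)
        = (\<integral>\<^sup>+ f. ennreal (1 / t\<^sup>2) * (if Q (t, f) then 1 else 0) \<partial>H)"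
      by (rule nn_integral_cmult[symmetric]) measurable
    then show "ennreal (1 / t\<^sup>2) * (\<integral>\<^sup>+ f. (if Q (t, f) then 1 else 0) \<partial>H) * indicator {0<..} t
        = (\<integral>\<^sup>+ f. (if 0 < t \<and> Q (t, f) then ennreal (1 / t\<^sup>2) else 0) \<partial>H)"
      by (auto split: split_indicator intro!: nn_integral_cong)
  qed
  also have "\<dots> = (\<integral>\<^sup>+ f. (\<integral>\<^sup>+ t. (if 0 < t \<and> Q (t, f) then ennreal (1 / t\<^sup>2) else 0) \<partial>lborel) \<partial>H)"
    by (rule Fubini'[symmetric]) measurable
  finally show "emeasure (spectral_intensity H) ?A
       = (\<integral>\<^sup>+ f. (\<integral>\<^sup>+ t. (if 0 < t \<and> Q (t, f) then ennreal (1 / t\<^sup>2) else 0) \<partial>lborel) \<partial>H)" .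
qed

text \<open>The Poisson weights sum to \<open>exp (- a) * exp a = 1\<close> with
  \<open>a = measure \<mu> A\<close>, leaving no mass for an infinite count.\<close>

lemma poisson_AE_finite:
  assumes N: "poisson_point_process \<Omega> \<mu> N" and A: "A \<in> sets \<mu>" "emeasure \<mu> A < \<infinity>"
  shows "AE \<omega> in \<Omega>. finite (N \<omega> \<inter> A)"
proof -
  interpret prob_space \<Omega> using N by (simp add: poisson_point_process_def)
  let ?B = "\<lambda>k. {\<omega> \<in> space \<Omega>. num_points (N \<omega>) A = of_nat k}"
  have [measurable]: "(\<lambda>\<omega>. num_points (N \<omega>) A) \<in> borel_measurable \<Omega>"
    and B: "measure \<Omega> (?B k) = exp (- measure \<mu> A) * measure \<mu> A ^ k / fact k" for k
    using N A unfolding poisson_point_process_def by blast+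
  have "(\<lambda>k. measure \<Omega> (?B k)) sums measure \<Omega> (\<Union>k. ?B k)"
    by (intro finite_measure_UNION) (auto simp: disjoint_family_on_def)
  moreover have "(\<lambda>k. exp (- measure \<mu> A) * (measure \<mu> A ^ k /\<^sub>R fact k)) sums (exp (- measure \<mu> A) * exp (measure \<mu> A))"
    by (intro sums_mult exp_converges)
  ultimately have "measure \<Omega> (\<Union>k. ?B k) = exp (- measure \<mu> A) * exp (measure \<mu> A)"
    by (simp add: B divide_inverse mult_ac sums_iff)
  then have "prob (\<Union>k. ?B k) = 1"
    by (simp add: exp_minus)
  then have "AE \<omega> in \<Omega>. \<omega> \<in> (\<Union>k. ?B k)"
    by (rule AE_prob_1)
  then show ?thesis
  proof eventually_elim
    case (elim \<omega>)
    then obtain k where "emeasure (count_space UNIV) (N \<omega> \<inter> A) = of_nat k"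
      by (auto simp: num_points_def)
    then show ?case
      by (metis emeasure_count_space_infinite top_greatest ennreal_of_nat_neq_top infinity_ennreal_def)
  qed
qed

lemma poisson_AE_empty:
  assumes N: "poisson_point_process \<Omega> \<mu> N" and A: "A \<in> null_sets \<mu>"
  shows "AE \<omega> in \<Omega>. N \<omega> \<inter> A = {}"
proof -
  interpret prob_space \<Omega> using N by (simp add: poisson_point_process_def)
  have "\<forall>k::nat. prob {\<omega> \<in> space \<Omega>. num_points (N \<omega>) A = of_nat k} = exp (- measure \<mu> A) * measure \<mu> A ^ k / fact k"
    using N A unfolding poisson_point_process_def by (auto simp: null_sets_def)
  from spec[OF this, of 0] have "prob {\<omega> \<in> space \<Omega>. num_points (N \<omega>) A = 0} = 1"
    using A by (simp add: measure_eq_emeasure_eq_ennreal[of 0] null_sets_def)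
  then have "AE \<omega> in \<Omega>. \<omega> \<in> {\<omega> \<in> space \<Omega>. num_points (N \<omega>) A = 0}"
    by (rule AE_prob_1)
  then show ?thesis
    by eventually_elim (auto simp: num_points_def emeasure_count_space_eq_0)
qed

text \<open>
  Only finitely many points of the process contribute above any positive level. If \<open>R\<close> vanished
  almost everywhere, it would therefore vanish on a finite maximum that is bounded away from 0.
\<close>

lemma spectral_functional_integral_pos:
  assumes nonneg: "\<And>f y. f \<in> topspace X \<Longrightarrow> 0 \<le> f y"
    and borel: "borel_measure_on X H" and lf: "locally_finite_on X H"
    and sup_meas[measurable]: "sup_fun \<in> borel_measurable H" and fin: "sup_mass H < \<infinity>"
    and N: "poisson_point_process \<Omega> (spectral_intensity H) N"
    and Zpos: "AE \<omega> in \<Omega>. 0 < (INF y. max_stable_process (N \<omega>) y)"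
    and R: "spectral_functional R" and R_meas[measurable]: "R \<in> borel_measurable H"
  shows "0 < (\<integral>\<^sup>+ f. R f \<partial>H)"
proof (rule ccontr)
  assume "\<not> 0 < (\<integral>\<^sup>+ f. R f \<partial>H)"
  then have R0: "AE f in H. R f = 0"
    by (simp add: nn_integral_0_iff_AE zero_less_iff_neq_zero)
  interpret prob_space \<Omega> using N by (simp add: poisson_point_process_def)
  have H: "sigma_finite_measure H"
    by (rule sigma_finite_spectral_measure[OF _ borel lf sup_meas fin]) (rule nonneg)
  have spH: "space H = topspace X"
    using borel by (simp add: borel_measure_on_def)
  define B where "B = {p \<in> {0::real<..} \<times> space H. R (snd p) \<noteq> 0}"
  \<comment> \<open>Points able to exceed \<open>1 / (n + 1)\<close> somewhere. For a function with
    supremum \<open>s > 0\<close>, the integral of the inverse square from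
    \<open>1 / ((n + 1) * s)\<close> on is \<open>(n + 1) * s\<close>, so the intensity of the set
    is at most \<open>(n + 1) * c\<close>. All \<open>n\<close> are treated at once because the
    infimum of the process is random.\<close>
  define A where "A = (\<lambda>n::nat. {p \<in> {0::real<..} \<times> space H. ennreal (inverse (real (Suc n))) < ennreal (fst p) * sup_fun (snd p)})"
  have "emeasure (spectral_intensity H) B
      = (\<integral>\<^sup>+ f. (\<integral>\<^sup>+ t. (if 0 < t \<and> R f \<noteq> 0 then ennreal (1 / t\<^sup>2) else 0) \<partial>lborel) \<partial>H)"
    unfolding B_def
    using emeasure_spectral_intensity(2)[OF H, of "\<lambda>p. R (snd p) \<noteq> 0"] by simp
  also have "\<dots> = (\<integral>\<^sup>+ f. 0 \<partial>H)"
    by (rule nn_integral_cong_AE, rule eventually_mono[OF R0]) simp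
  finally have "emeasure (spectral_intensity H) B = (\<integral>\<^sup>+ f. 0 \<partial>H)" .
  moreover have "B \<in> sets (spectral_intensity H)"
    unfolding B_def by (rule emeasure_spectral_intensity[OF H]) measurable
  ultimately have "AE \<omega> in \<Omega>. N \<omega> \<inter> B = {}"
    by (intro poisson_AE_empty[OF N]) (simp add: null_sets_def)
  moreover have "AE \<omega> in \<Omega>. \<forall>n. finite (N \<omega> \<inter> A n)"
  proof (subst AE_all_countable, intro allI poisson_AE_finite[OF N])
    fix n :: nat
    let ?e = "inverse (real (Suc n))"
    show "A n \<in> sets (spectral_intensity H)"
      unfolding A_def by (rule emeasure_spectral_intensity[OF H]) measurable
    have sup_fin: "AE f in H. sup_fun f \<noteq> \<infinity>"
      using fin by (intro nn_integral_PInf_AE) (auto simp: sup_mass_def)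
    have "emeasure (spectral_intensity H) (A n)
      = (\<integral>\<^sup>+ f. (\<integral>\<^sup>+ t. (if 0 < t \<and> ennreal ?e < ennreal t * sup_fun f then ennreal (1 / t\<^sup>2) else 0) \<partial>lborel) \<partial>H)"
      unfolding A_def by (subst emeasure_spectral_intensity[OF H]) simp_all
    also have "\<dots> \<le> (\<integral>\<^sup>+ f. of_nat (Suc n) * sup_fun f \<partial>H)"
    proof (rule nn_integral_mono_AE, rule eventually_mono[OF sup_fin])
      fix f :: "'a \<Rightarrow> real" assume "sup_fun f \<noteq> \<infinity>"
      then obtain s where s: "0 \<le> s" "sup_fun f = ennreal s"
        by (cases "sup_fun f") auto
      show "(\<integral>\<^sup>+ t. (if 0 < t \<and> ennreal ?e < ennreal t * sup_fun f then ennreal (1 / t\<^sup>2) else 0) \<partial>lborel) \<le> of_nat (Suc n) * sup_fun f"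
      proof (cases "s = 0")
        case False
        have "(\<integral>\<^sup>+ t. (if 0 < t \<and> ennreal ?e < ennreal t * sup_fun f then ennreal (1 / t\<^sup>2) else 0) \<partial>lborel)
          \<le> (\<integral>\<^sup>+ t. ennreal (1 / t\<^sup>2) * indicator {?e / s..} t \<partial>lborel)"
        proof (rule nn_integral_mono)
          fix t :: real
          have "?e / s \<le> t" if "0 < t" "ennreal ?e < ennreal t * sup_fun f"
          proof -
            have "?e < t * s"
              using that s by (simp add: ennreal_mult[symmetric] ennreal_less_iff del: of_nat_Suc)
            then show ?thesis using s False by (simp add: field_simps del: of_nat_Suc)
          qed
          then show "(if 0 < t \<and> ennreal ?e < ennreal t * sup_fun f then ennreal (1 / t\<^sup>2) else 0)
            \<le> ennreal (1 / t\<^sup>2) * indicator {?e / s..} t"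
            by (auto split: split_indicator)
        qed
        also have "\<dots> = ennreal (1 / (?e / s))"
          using s False by (intro nn_integral_inverse_square) simp
        also have "1 / (?e / s) = real (Suc n) * s"
          by (simp add: field_simps)
        also have "ennreal (real (Suc n) * s) = of_nat (Suc n) * sup_fun f"
          using s by (simp add: ennreal_mult ennreal_of_nat_eq_real_of_nat del: of_nat_Suc)
        finally show ?thesis .
      qed (simp add: s)
    qed
    also have "\<dots> = of_nat (Suc n) * sup_mass H"
      unfolding sup_mass_def by (rule nn_integral_cmult) simp
    also have "\<dots> < \<infinity>"
      using fin by (simp add: ennreal_mult_less_top of_nat_less_top del: of_nat_Suc)
    finally show "emeasure (spectral_intensity H) (A n) < \<infinity>" .
  qed
  moreover note Zpos AE_space
  ultimately have "AE \<omega> in \<Omega>. False"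
  proof eventually_elim
    case (elim \<omega>)
    have sub: "N \<omega> \<subseteq> {0<..} \<times> space H"
      using N elim by (auto simp: poisson_point_process_def space_spectral_intensity[symmetric])
    \<comment> \<open>The infimum may be infinite, so a finite level strictly below it is chosen
      before one of the form \<open>1 / (n + 1)\<close>.\<close>
    obtain w where w: "0 < w" "w < (INF y. max_stable_process (N \<omega>) y)"
      using elim dense by blast
    then obtain z where "0 < z" "w = ennreal z"
      by (cases w) auto
    with w have z: "0 < z" "ennreal z < (INF y. max_stable_process (N \<omega>) y)"
      by simp_all
    from z(1) obtain n where n: "inverse (real (Suc n)) < z"
      using reals_Archimedean by blast
    define e where "e = inverse (real (Suc n))"
    have e: "0 < e" "ennreal e \<le> ennreal z"
      using n z(1) by (auto simp: e_def ennreal_leI)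
    define I where "I = N \<omega> \<inter> A n"
    have I: "finite I" using elim by (simp add: I_def)
    have pos: "0 < fst p" "snd p \<in> space H" "0 \<le> snd p y" "R (snd p) = 0" if "p \<in> I" for p y
      using that sub elim nonneg[of "snd p"] spH by (auto simp: I_def B_def mem_Times_iff subset_eq)
    \<comment> \<open>A supremum above \<open>e\<close> forces a single point to exceed
      \<open>e\<close> at \<open>y\<close>; that point lies in \<open>A n\<close> because its own
      supremum is at least its value at \<open>y\<close>.\<close>
    have ex: "\<exists>p\<in>I. e < fst p * snd p y" for y
    proof -
      have "ennreal e < max_stable_process (N \<omega>) y"
        using e(2) z(2) by (meson INF_lower UNIV_I le_less_trans less_le_trans)
      then obtain t f where p: "(t, f) \<in> N \<omega>" "ennreal e < ennreal (t * f y)"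
        unfolding max_stable_process_def less_SUP_iff by auto
      then have t: "0 < t" "f \<in> space H"
        using sub by auto
      have "ennreal (t * f y) = ennreal t * ennreal (f y)"
        using t by (simp add: ennreal_mult')
      also have "\<dots> \<le> ennreal t * sup_fun f"
        unfolding sup_fun_def by (intro mult_left_mono SUP_upper) simp_all
      finally have "(t, f) \<in> I"
        using p t by (auto simp: I_def A_def e_def)
      moreover have "e < t * f y"
        using p(2) e(1) by (simp add: ennreal_less_iff)
      ultimately show ?thesis by force
    qed
    then have ne: "I \<noteq> {}" by blast
    have "ennreal e = R (\<lambda>_. e)"
      using spectral_functional_const[OF R e(1)] by simp
    also have "\<dots> \<le> R (\<lambda>y. MAX p\<in>I. fst p * snd p y)"
    proof (rule spectral_functional_mono[OF R])
      show "e \<le> (MAX p\<in>I. fst p * snd p y)" for y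
        using ex[of y] I ne by (subst Max_ge_iff) (auto intro: less_imp_le)
    qed (use e in simp)
    also have "\<dots> = (MAX p\<in>I. ennreal (fst p) * R (snd p))"
      using I ne pos by (intro spectral_functional_Max[OF R]) auto
    also have "\<dots> = (MAX p\<in>I. 0)"
      using pos by (intro arg_cong[where f=Max] image_cong) auto
    also have "\<dots> = 0"
      using ne by (simp add: image_constant_conv)
    finally show False
      using e(1) by simp
  qed
  then show False
    by simp
qed

section \<open>Optimality of the normalized density\<close>

text \<open>Division by a positive finite number is an order embedding of \<open>ennreal\<close>. In
  the application only \<open>p\<close> depends on the functional, so all three problems have the
  minimizers of \<open>max_ratio H\<close>.\<close>

lemma arg_min_set_scaled:
  assumes Q: "\<And>x. A x \<Longrightarrow> Q x = D x / p" and p: "0 < p" "p < (\<infinity>::ennreal)"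
    and x0: "A x0" "D x0 = c" and D: "\<And>x. A x \<Longrightarrow> c \<le> D x" and c: "c < \<infinity>"
  shows "arg_min_set Q A = {x. A x \<and> D x = c}" and "solvable Q A"
proof -
  have le: "a / p \<le> b / p \<longleftrightarrow> a \<le> b" for a b
    using divide_less_ennreal[of p b "a / p"] p by (auto simp: not_less[symmetric] ennreal_divide_times)
  have less: "a / p < b / p \<longleftrightarrow> a < b" for a b
    using le[of b a] by (simp add: not_le[symmetric])
  have "is_arg_min Q A x \<longleftrightarrow> A x \<and> D x = c" for x
  proof
    assume "is_arg_min Q A x"
    then have "A x" "\<not> Q x0 < Q x"
      using x0 by (auto simp: is_arg_min_def)
    then show "A x \<and> D x = c"
      using x0 D[of x] by (auto simp: Q less not_less)
  next
    assume "A x \<and> D x = c"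
    then show "is_arg_min Q A x"
      using D by (auto simp: is_arg_min_def Q less not_less le)
  qed
  then show "arg_min_set Q A = {x. A x \<and> D x = c}"
    by (auto simp: arg_min_set_def)
  have inf: "(INF x\<in>Collect A. Q x) = c / p"
  proof (rule antisym)
    show "(INF x\<in>Collect A. Q x) \<le> c / p"
      using x0 by (intro INF_lower2[of x0]) (auto simp: Q)
    show "c / p \<le> (INF x\<in>Collect A. Q x)"
      using D by (intro INF_greatest) (auto simp: Q le)
  qed
  have "c / p < \<infinity>"
    using p c by (auto simp: ennreal_divide_eq_top_iff less_top[symmetric])
  then show "solvable Q A"
    unfolding solvable_def inf using x0 Q by auto
qed

text \<open>The identity is pointwise: for unbounded \<open>f\<close> both sides are infinite. Hence
  the density vanishes only where \<open>sup_fun\<close> does.\<close>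

lemma admissible_normalized_density:
  assumes [measurable]: "sup_fun \<in> borel_measurable H" and c: "0 < sup_mass H" "sup_mass H < \<infinity>"
  shows "admissible H (normalized_density H)"
    and "sup_fun f = sup_mass H * normalized_density H f"
proof -
  have "sup_mass H \<noteq> 0" "sup_mass H \<noteq> \<top>"
    using c by auto
  then have eq: "sup_fun f = sup_mass H * normalized_density H f" for f
    by (simp add: normalized_density_def ennreal_times_divide mult.commute[of "sup_mass H"] ennreal_mult_divide_eq)
  then show "sup_fun f = sup_mass H * normalized_density H f" .
  have "{f \<in> space H. normalized_density H f = 0 \<and> 0 < sup_fun f} = {}"
    by (subst eq) auto
  moreover have "(\<integral>\<^sup>+ f. normalized_density H f \<partial>H) = 1"
    unfolding normalized_density_def
    using c by (subst nn_integral_divide) (simp_all add: sup_mass_def[symmetric])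
  ultimately show "admissible H (normalized_density H)"
    unfolding admissible_def by (simp only: null_sets.empty_sets) (simp add: normalized_density_def[abs_def])
qed

text \<open>In case of equality, \<open>sup_fun f\<close> lies below \<open>sup_mass H * g f\<close>
  almost everywhere and both have the same finite integral, so they agree almost everywhere.\<close>

lemma max_ratio_eq_sup_mass_iff:
  assumes sup_meas[measurable]: "sup_fun \<in> borel_measurable H" and c: "0 < sup_mass H" "sup_mass H < \<infinity>"
    and adm: "admissible H g"
  shows "max_ratio H g = sup_mass H \<longleftrightarrow> (AE f in H. g f = normalized_density H f)"
proof
  note [measurable] = density_measurable[OF adm sup_meas]
  note eq = admissible_normalized_density(2)[OF sup_meas c]
  assume "max_ratio H g = sup_mass H"
  then have le: "AE f in H. sup_fun f \<le> sup_mass H * g f"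
    using max_ratio_le_iff[OF adm sup_meas] by (metis order_refl)
  have "(\<integral>\<^sup>+ f. sup_mass H * g f \<partial>H) = sup_mass H"
    using adm by (simp add: nn_integral_cmult admissible_def)
  moreover have "(\<integral>\<^sup>+ f. sup_mass H * g f - sup_fun f \<partial>H) = (\<integral>\<^sup>+ f. sup_mass H * g f \<partial>H) - (\<integral>\<^sup>+ f. sup_fun f \<partial>H)"
    using le c by (intro nn_integral_diff) (simp_all add: sup_mass_def)
  ultimately have "(\<integral>\<^sup>+ f. sup_mass H * g f - sup_fun f \<partial>H) = 0"
    using c by (simp add: sup_mass_def)
  then have "AE f in H. sup_mass H * g f - sup_fun f = 0"
    by (simp add: nn_integral_0_iff_AE)
  moreover have "AE f in H. g f < \<infinity>"
    using AE_admissible[OF adm sup_meas] by (rule eventually_mono) simp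
  ultimately show "AE f in H. g f = normalized_density H f"
    using le
  proof eventually_elim
    case (elim f)
    \<comment> \<open>A vanishing truncated difference yields one inequality; the other is
      \<open>le\<close>.\<close>
    then have "sup_mass H * g f = sup_fun f"
      using c by (intro antisym) (auto simp: diff_eq_0_iff_ennreal ennreal_mult_eq_top_iff)
    then show ?case
      using c unfolding eq by (auto simp: ennreal_mult_cancel_left)
  qed
next
  assume "AE f in H. g f = normalized_density H f"
  then have "max_ratio H g \<le> sup_mass H"
    unfolding max_ratio_le_iff[OF adm sup_meas]
    by (rule eventually_mono) (simp add: admissible_normalized_density(2)[OF sup_meas c])
  then show "max_ratio H g = sup_mass H"
    using sup_mass_le_max_ratio[OF adm sup_meas] by (rule antisym)
qed

theorem corollary3p5:
  fixes X :: "('k::polish_space \<Rightarrow> real) topology"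
    and H :: "('k \<Rightarrow> real) measure"
    and \<Omega> :: "'v measure"
    and N :: "'v \<Rightarrow> (real \<times> ('k \<Rightarrow> real)) set"
    and P :: "(('k \<Rightarrow> real) \<Rightarrow> ennreal) \<Rightarrow> 'w measure"
    and E :: "(('k \<Rightarrow> real) \<Rightarrow> ennreal) \<Rightarrow> nat \<Rightarrow> 'w \<Rightarrow> real"
    and F :: "(('k \<Rightarrow> real) \<Rightarrow> ennreal) \<Rightarrow> nat \<Rightarrow> 'w \<Rightarrow> 'k \<Rightarrow> real"
    and T :: "('k \<Rightarrow> real) \<Rightarrow> real"
  defines "Q_T \<equiv> (\<lambda>g. expected_number H (\<lambda>h. ennreal (T h)) g (P g) (E g) (F g))"
    and "Q_1 \<equiv> (\<lambda>g. expected_number H sup_fun g (P g) (E g) (F g))"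
    and "Q_2 \<equiv> (\<lambda>y0 g. expected_number H (\<lambda>h. ennreal (h y0)) g (P g) (E g) (F g))"
  assumes "compact (UNIV :: 'k set)"
    and "polish_topology X"
    and "\<And>f y. f \<in> topspace X \<Longrightarrow> 0 \<le> f y"
    and "borel_measure_on X H"
    and "locally_finite_on X H"
    and "\<And>y. (\<lambda>f. f y) \<in> borel_measurable H"
    and "\<And>y. (\<integral>\<^sup>+ f. ennreal (f y) \<partial>H) = 1"
    and "poisson_point_process \<Omega> (spectral_intensity H) N"
    and "AE \<omega> in \<Omega>. 0 < (INF y. max_stable_process (N \<omega>) y)"
    and "sup_fun \<in> borel_measurable H"
    and "\<And>g. admissible H g \<Longrightarrow> simulation_input H g (P g) (E g) (F g)"
    and "max_linear T"
    and "T (\<lambda>_. 1) = 1"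
    and "T \<in> borel_measurable H"
  shows "(solvable Q_T (admissible H) \<longleftrightarrow> sup_mass H < \<infinity>) \<and>
    (sup_mass H < \<infinity> \<longrightarrow>
       normalized_density H \<in> arg_min_set Q_T (admissible H) \<and>
       arg_min_set Q_T (admissible H) = arg_min_set Q_1 (admissible H) \<and>
       (\<forall>y0. arg_min_set Q_T (admissible H) = arg_min_set (Q_2 y0) (admissible H)) \<and>
       (AE f in density H (normalized_density H). (SUP y. ennreal (f y) / normalized_density H f) = sup_mass H) \<and>
       (\<forall>g\<in>arg_min_set Q_T (admissible H). AE f in H. g f = normalized_density H f))"
proof -
  note nonneg = assms(6) and borel = assms(7) and lf = assms(8) and eval_meas = assms(9)
    and eval_int = assms(10) and poisson = assms(11) and Zpos = assms(12) and sup_meas[measurable] = assms(13)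
    and sim = assms(14) and T = assms(15) and T1 = assms(16)
  have nonneg_H: "0 \<le> f y" if "f \<in> space H" for f y
    using nonneg borel that by (simp add: borel_measure_on_def)
  let ?c = "sup_mass H" and ?A = "admissible H"
  have RT: "spectral_functional (\<lambda>h. ennreal (T h))"
    by (rule spectral_functional_max_linear[OF T T1])
  have RT_meas: "(\<lambda>h. ennreal (T h)) \<in> borel_measurable H"
    using assms(17) by measurable
  \<comment> \<open>The supremum dominates any single evaluation, whose integral is 1.\<close>
  have one_le: "1 \<le> ?c"
  proof -
    fix y :: 'k
    have "(\<integral>\<^sup>+ f. ennreal (f y) \<partial>H) \<le> ?c"
      unfolding sup_mass_def sup_fun_def by (intro nn_integral_mono SUP_upper) simp
    then show ?thesis
      by (simp add: eval_int)
  qed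
  then have c_pos: "0 < ?c"
    by (rule less_le_trans[rotated]) simp
  show ?thesis
  proof (cases "?c < \<infinity>")
    case False
    \<comment> \<open>Every admissible density has ratio at least \<open>c\<close>, so with
      \<open>c\<close> infinite the rule almost surely never stops.\<close>
    have "Q_T g = \<infinity>" if "?A g" for g
    proof -
      have "max_ratio H g = \<infinity>"
        using False sup_mass_le_max_ratio[OF that sup_meas] by (simp add: not_less top_unique)
      then show ?thesis
        unfolding Q_T_def using sim[OF that]
        by (intro expected_number_infinite[OF that sup_meas]) (simp_all add: simulation_input_def)
    qed
    then have "(INF g\<in>Collect ?A. Q_T g) = \<infinity>"
      by (simp add: INF_eq_const)
    then show ?thesis
      using False by (simp add: solvable_def)
  next
    case True
    note norm_adm = admissible_normalized_density(1)[OF sup_meas c_pos True]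
      and norm_eq = admissible_normalized_density(2)[OF sup_meas c_pos True]
    have c_le: "?c \<le> max_ratio H g" if "?A g" for g
      by (rule sup_mass_le_max_ratio[OF that sup_meas])
    \<comment> \<open>The set of minimizers is described without \<open>R\<close>; instantiating
      \<open>R\<close> three times therefore gives the equality of the three sets.\<close>
    have opt: "arg_min_set (\<lambda>g. expected_number H R g (P g) (E g) (F g)) ?A = {g. ?A g \<and> max_ratio H g = ?c}"
        "solvable (\<lambda>g. expected_number H R g (P g) (E g) (F g)) ?A"
      if R: "spectral_functional R" and R_meas: "R \<in> borel_measurable H" for R
    proof -
      have p: "0 < (\<integral>\<^sup>+ f. R f \<partial>H)"
        by (rule spectral_functional_integral_pos[OF _ borel lf sup_meas True poisson Zpos R R_meas]) (rule nonneg)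
      have "(\<integral>\<^sup>+ f. R f \<partial>H) \<le> ?c"
        unfolding sup_mass_def by (intro nn_integral_mono spectral_functional_le_sup[OF R] nonneg_H)
      then have p_fin: "(\<integral>\<^sup>+ f. R f \<partial>H) < \<infinity>"
        using True by (rule le_less_trans)
      have Q: "expected_number H R g (P g) (E g) (F g) = max_ratio H g / (\<integral>\<^sup>+ f. R f \<partial>H)" if "?A g" for g
      proof -
        interpret spectral_simulation H g R "P g" "E g" "F g"
          using that sup_meas nonneg_H sim[OF that] R R_meas True by (intro spectral_simulation.intro)
        show ?thesis by (rule expected_number_eq[OF p])
      qed
      have "max_ratio H (normalized_density H) = ?c"
        using max_ratio_eq_sup_mass_iff[OF sup_meas c_pos True norm_adm] by simp
      with arg_min_set_scaled[where A="?A" and D="max_ratio H", OF Q p p_fin norm_adm _ c_le True]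
      show "arg_min_set (\<lambda>g. expected_number H R g (P g) (E g) (F g)) ?A = {g. ?A g \<and> max_ratio H g = ?c}"
        "solvable (\<lambda>g. expected_number H R g (P g) (E g) (F g)) ?A"
        by auto
    qed
    have Q_T: "arg_min_set Q_T ?A = {g. ?A g \<and> max_ratio H g = ?c}" "solvable Q_T ?A"
      unfolding Q_T_def by (rule opt[OF RT RT_meas])+
    have Q_1: "arg_min_set Q_1 ?A = {g. ?A g \<and> max_ratio H g = ?c}"
      unfolding Q_1_def by (rule opt[OF spectral_functional_sup_fun sup_meas])
    have Q_2: "arg_min_set (Q_2 y0) ?A = {g. ?A g \<and> max_ratio H g = ?c}" for y0
      unfolding Q_2_def by (rule opt[OF spectral_functional_eval]) (use eval_meas in measurable)
    have "AE f in H. sup_fun f \<noteq> \<infinity>"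
      using True by (intro nn_integral_PInf_AE) (auto simp: sup_mass_def)
    then have "AE f in H. 0 < normalized_density H f \<longrightarrow> (SUP y. ennreal (f y) / normalized_density H f) = ?c"
    proof (eventually_elim, intro impI)
      fix f assume f: "sup_fun f \<noteq> \<infinity>" "0 < normalized_density H f"
      have "normalized_density H f \<noteq> \<infinity>"
        using f(1) norm_eq[of f] c_pos by (auto simp: ennreal_mult_top split: if_splits)
      have "(SUP y. ennreal (f y) / normalized_density H f) = sup_fun f / normalized_density H f"
        unfolding sup_fun_def by (rule SUP_divide_ennreal[symmetric])
      also have "\<dots> = ?c"
        unfolding norm_eq[of f] using f(2) \<open>normalized_density H f \<noteq> \<infinity>\<close>
        by (simp add: ennreal_mult_divide_eq)
      finally show "(SUP y. ennreal (f y) / normalized_density H f) = ?c" .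
    qed
    then have "AE f in density H (normalized_density H). (SUP y. ennreal (f y) / normalized_density H f) = ?c"
      using norm_adm by (subst AE_density) (auto simp: admissible_def)
    then show ?thesis
      using True norm_adm Q_T Q_1 Q_2 max_ratio_eq_sup_mass_iff[OF sup_meas c_pos True]
      by auto
  qed
qed

end
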